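(* Let $Z_i=(X_i,Y_i)$, $i=1,\dots,n+1$, be i.i.d. from a distribution $\mathcal P_{XY}$, let $V(\cdot)$ be a fixed real-valued score function, $V_i=V(Z_i)$, and let $P_{V|x}(v)=\mathbb P(V(Z)\le v\mid X=x)$. Use the localizer $H(x_1,x_2)=\exp(-d(x_1,x_2)/h_n)$, where $h_n>0$ is a bandwidth and $d(x_1,x_2)\ge0$ with $d(x,x)=0$. Assume: $X$ has a continuous distribution on $[0,1]^p$ and $V(Z)$ has a continuous distribution conditional on $X=x$; there exist constants $L>0$, $\beta\ge0$ such that the density of $X$ satisfies $p_X(x)\ge1/L$ on $[0,1]^p$ and (i) $\max_{v\in\mathbb R}|P_{V|x}(v)-P_{V|x'}(v)|\le L\,d(x,x')$ for all $x,x'\in[0,1]^p$; (ii) $\mathbb P(d(x_0,X)\le\varepsilon)\ge\varepsilon^\beta/L$ for all $\varepsilon\le h_n$ and all $x_0\in[0,1]^p$; (iii) $h_n\to0$ and $nh_n^\beta/\ln n\to\infty$ as $n\to\infty$. Put $H_{ij}=H(X_i,X_j)$, $p^H_{ij}=H_{ij}/\sum_{k=1}^{n+1}H_{ik}$, $\Gamma=\{\sum_{k\in I}p^H_{ik}: i\in\{1,\dots,n+1\},\ I\subseteq\{1,\dots,n+1\}\}$, $\hat{\mathcal F}_i(v)=\sum_{j=1}^{n}p^H_{ij}\delta_{V_j}+p^H_{i,n+1}\delta_v$ and $\hat{\mathcal F}=\sum_{j=1}^np^H_{n+1,j}\delta_{V_j}+p^H_{n+1,n+1}\delta_{+\infty}$.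 Fix $\alpha\in(0,1)$; for each $v$ let $\tilde\alpha(v)$ be the smallest $\tilde\alpha\in\Gamma$ with $\frac{1}{n+1}\sum_{i=1}^{n+1}\mathbb 1\{V_i\le Q(\tilde\alpha;\hat{\mathcal F}_i(v))\}\ge\alpha$ (with $V_{n+1}=v$ in this sum), and $C_V(X_{n+1})=\{v: v\le Q(\tilde\alpha(v);\hat{\mathcal F})\}$. Then for any $x_0\in[0,1]^p$: $$\lim_{n\to\infty}\mathbb P(V_{n+1}\in C_V(X_{n+1})\mid X_{n+1}=x_0)=\alpha,$$ $$\lim_{n\to\infty}\mathbb P(V_{n+1}\le Q(\alpha;\hat{\mathcal F})\mid X_{n+1}=x_0)=\alpha,$$ $$\lim_{n\to\infty}\mathbb P\big(\max_v|\tilde\alpha(v)-\alpha|<\varepsilon\mid X_{n+1}=x_0\big)=1\quad\text{for all }\varepsilon>0.$$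
   Context: For a distribution $\mathcal F$ on $\mathbb R\cup\{+\infty\}$, $Q(\alpha;\mathcal F)=\inf\{t:\mathbb P_{T\sim\mathcal F}(T\le t)\ge\alpha\}$; $\delta_v$ is the point mass at $v$. *)

theory Defs
  imports "HOL-Probability.Probability"
begin

definition unit_cube :: "(real^'p) set" where
  "unit_cube = {x. \<forall>i. 0 \<le> x $ i \<and> x $ i \<le> 1}"

definition locH :: "('x \<Rightarrow> 'x \<Rightarrow> real) \<Rightarrow> real \<Rightarrow> 'x \<Rightarrow> 'x \<Rightarrow> real" where
  "locH d hb x1 x2 = exp (- d x1 x2 / hb)"

definition pH :: "('x \<Rightarrow> 'x \<Rightarrow> real) \<Rightarrow> real \<Rightarrow> nat \<Rightarrow> (nat \<Rightarrow> 'x) \<Rightarrow> nat \<Rightarrow> nat \<Rightarrow> real" where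
  "pH d hb n X i j = locH d hb (X i) (X j) / (\<Sum>k=1..n+1. locH d hb (X i) (X k))"

definition Gamma_set :: "('x \<Rightarrow> 'x \<Rightarrow> real) \<Rightarrow> real \<Rightarrow> nat \<Rightarrow> (nat \<Rightarrow> 'x) \<Rightarrow> real set" where
  "Gamma_set d hb n X = {(\<Sum>k\<in>I. pH d hb n X i k) | i I. i \<in> {1..n+1} \<and> I \<subseteq> {1..n+1}}"

text \<open>Quantile Q(a;F) = inf{t : P(T <= t) >= a}, where a distribution on the extended
  line is given through its CDF t |-> P(T <= t).\<close>
definition quantile :: "real \<Rightarrow> (ereal \<Rightarrow> real) \<Rightarrow> ereal" where
  "quantile a F = Inf {t. F t \<ge> a}"

definition Fi_cdf :: "('x \<Rightarrow> 'x \<Rightarrow> real) \<Rightarrow> real \<Rightarrow> nat \<Rightarrow> (nat \<Rightarrow> 'x) \<Rightarrow> (nat \<Rightarrow> real)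
    \<Rightarrow> nat \<Rightarrow> real \<Rightarrow> ereal \<Rightarrow> real" where
  "Fi_cdf d hb n X Vs i v t =
     (\<Sum>j=1..n. pH d hb n X i j * (if ereal (Vs j) \<le> t then 1 else 0))
     + pH d hb n X i (n+1) * (if ereal v \<le> t then 1 else 0)"

definition Ftest_cdf :: "('x \<Rightarrow> 'x \<Rightarrow> real) \<Rightarrow> real \<Rightarrow> nat \<Rightarrow> (nat \<Rightarrow> 'x) \<Rightarrow> (nat \<Rightarrow> real)
    \<Rightarrow> ereal \<Rightarrow> real" where
  "Ftest_cdf d hb n X Vs t =
     (\<Sum>j=1..n. pH d hb n X (n+1) j * (if ereal (Vs j) \<le> t then 1 else 0))
     + pH d hb n X (n+1) (n+1) * (if (\<infinity>::ereal) \<le> t then 1 else 0)"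

definition alpha_tilde :: "('x \<Rightarrow> 'x \<Rightarrow> real) \<Rightarrow> real \<Rightarrow> nat \<Rightarrow> (nat \<Rightarrow> 'x) \<Rightarrow> (nat \<Rightarrow> real)
    \<Rightarrow> real \<Rightarrow> real \<Rightarrow> real" where
  "alpha_tilde d hb n X Vs \<alpha> v =
     Min {a \<in> Gamma_set d hb n X.
            (1 / real (n+1)) * (\<Sum>i=1..n+1.
               if ereal ((Vs(n+1 := v)) i) \<le> quantile a (Fi_cdf d hb n X Vs i v) then 1 else 0)
            \<ge> \<alpha>}"

definition C_V :: "('x \<Rightarrow> 'x \<Rightarrow> real) \<Rightarrow> real \<Rightarrow> nat \<Rightarrow> (nat \<Rightarrow> 'x) \<Rightarrow> (nat \<Rightarrow> real)
    \<Rightarrow> real \<Rightarrow> real set" where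
  "C_V d hb n X Vs \<alpha> = {v. ereal v \<le> quantile (alpha_tilde d hb n X Vs \<alpha> v) (Ftest_cdf d hb n X Vs)}"

definition joint_law :: "(real^'p) measure \<Rightarrow> 'y measure \<Rightarrow> (real^'p \<Rightarrow> 'y measure) \<Rightarrow> ((real^'p) \<times> 'y) measure" where
  "joint_law PX MY K = PX \<bind> (\<lambda>x. distr (K x) (borel \<Otimes>\<^sub>M MY) (\<lambda>y. (x, y)))"

text \<open>Law of Z_1..Z_{n+1} conditional on X_{n+1} = x0: Z_1..Z_n i.i.d. joint law,
  independent of Z_{n+1} = (x0, Y) with Y ~ K x0.\<close>
definition sample_law :: "(real^'p) measure \<Rightarrow> 'y measure \<Rightarrow> (real^'p \<Rightarrow> 'y measure) \<Rightarrow> nat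
    \<Rightarrow> real^'p \<Rightarrow> (nat \<Rightarrow> (real^'p) \<times> 'y) measure" where
  "sample_law PX MY K n x0 = PiM {1..n+1}
     (\<lambda>i. if i = n+1 then distr (K x0) (borel \<Otimes>\<^sub>M MY) (\<lambda>y. (x0, y)) else joint_law PX MY K)"

definition cond_cdf :: "'y measure \<Rightarrow> (real^'p \<Rightarrow> 'y measure) \<Rightarrow> ((real^'p) \<times> 'y \<Rightarrow> real) \<Rightarrow> real^'p \<Rightarrow> real \<Rightarrow> real" where
  "cond_cdf MY K V x v = measure (K x) {y \<in> space MY. V (x, y) \<le> v}"

end

theory Submission
  imports Defs "HOL-Real_Asymp.Real_Asymp"
begin

text \<open>
  Write \<open>U\<^sub>i(v)\<close> for the total weight \<open>p\<^sup>H\<^sub>i\<^sub>j\<close> of the scores strictly below \<open>V\<^sub>i\<close>, where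
  \<open>V\<^sub>n\<^sub>+\<^sub>1 = v\<close>. Then \<open>V\<^sub>i \<le> Q(a; F\<^sub>i(v))\<close> holds iff \<open>U\<^sub>i(v) < a\<close>, and likewise for the test
  distribution, so everything is a statement about the weighted ranks \<open>U\<^sub>i\<close>.

  The weighted rank is a ratio of two sums which, given \<open>Z\<^sub>i\<close>, have i.i.d. terms. Hence
  \<open>U\<^sub>i > W\<^sub>i + e\<close> with \<open>W\<^sub>i = P(V \<le> V\<^sub>i | X = X\<^sub>i)\<close> is a deviation event for a single i.i.d. sum, whose
  mean is at most \<open>-e \<mu> / 4\<close> and whose variance is of order \<open>\<mu> = E H(X\<^sub>i, X)\<close>, which is at least a
  constant times \<open>h\<^sup>\<beta>\<close>. A Chernoff bound gives probability at most \<open>exp(-c n h\<^sup>\<beta>)\<close>, and since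
  \<open>n h\<^sup>\<beta> / ln n\<close> tends to infinity a union bound over the \<open>n + 1\<close> rows shows that all
  \<open>|U\<^sub>i(v) - W\<^sub>i|\<close> are small, uniformly in \<open>v\<close>. The \<open>W\<^sub>i\<close> are i.i.d. uniform, so the fraction of
  \<open>U\<^sub>i(v)\<close> below \<open>a\<close> is close to \<open>a\<close>; this pins the calibrated level to \<open>\<alpha>\<close>, and both coverage
  events become \<open>W\<^sub>n\<^sub>+\<^sub>1 < \<alpha>\<close> up to small errors.
\<close>

subsection \<open>Weighted ranks\<close>

definition wrank :: "('x \<Rightarrow> 'x \<Rightarrow> real) \<Rightarrow> real \<Rightarrow> nat \<Rightarrow> (nat \<Rightarrow> 'x) \<Rightarrow> (nat \<Rightarrow> real) \<Rightarrow> nat \<Rightarrow> real" where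
  "wrank d hb n X W i = (\<Sum>j=1..n+1. pH d hb n X i j * (if W j < W i then 1 else 0))"

text \<open>The calibration constraint with the quantile comparisons replaced by ranks and
  multiplied through by \<open>n + 1\<close>.\<close>

definition coverage_ok :: "('x \<Rightarrow> 'x \<Rightarrow> real) \<Rightarrow> real \<Rightarrow> nat \<Rightarrow> (nat \<Rightarrow> 'x) \<Rightarrow> (nat \<Rightarrow> real) \<Rightarrow> real \<Rightarrow> real \<Rightarrow> bool" where
  "coverage_ok d hb n X W \<alpha> a \<longleftrightarrow>
     \<alpha> * real (n+1) \<le> (\<Sum>i=1..n+1. if wrank d hb n X W i < a then 1 else 0)"

text \<open>The left side fails exactly when some \<open>t\<close> below \<open>x\<close> already
  carries mass at least \<open>a\<close>. For a finite step function this happens iff its left limit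
  at \<open>x\<close> reaches \<open>a\<close>. The level \<open>a\<close> is an arbitrary real, so
  levels at or below 0 or above the total mass need no separate treatment.\<close>

lemma le_quantile_step_iff:
  fixes p :: "'i \<Rightarrow> real" and y :: "'i \<Rightarrow> ereal"
  assumes fin: "finite A" and p: "\<And>j. j \<in> A \<Longrightarrow> 0 \<le> p j"
  shows "ereal x \<le> quantile a (\<lambda>t. \<Sum>j\<in>A. p j * (if y j \<le> t then 1 else 0))
     \<longleftrightarrow> (\<Sum>j\<in>A. p j * (if y j < ereal x then 1 else 0)) < a"
proof
  assume le: "ereal x \<le> quantile a (\<lambda>t. \<Sum>j\<in>A. p j * (if y j \<le> t then 1 else 0))"
  show "(\<Sum>j\<in>A. p j * (if y j < ereal x then 1 else 0)) < a"
  proof (rule ccontr)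
    assume "\<not> ?thesis"
    then have ge: "a \<le> (\<Sum>j\<in>A. p j * (if y j < ereal x then 1 else 0))" by simp
    \<comment> \<open>The largest jump point below \<open>x\<close>, where the distribution function
      already equals its left limit at \<open>x\<close>. The inserted \<open>-\<infinity>\<close>
      covers the case of no jump point below \<open>x\<close>.\<close>
    define t where "t = Max (insert (-\<infinity>) (y ` {j\<in>A. y j < ereal x}))"
    have fin': "finite (insert (-\<infinity>) (y ` {j\<in>A. y j < ereal x}))" using fin by simp
    have "t \<in> insert (-\<infinity>) (y ` {j\<in>A. y j < ereal x})"
      unfolding t_def by (rule Max_in) (use fin' in auto)
    then have tx: "t < ereal x" by auto
    have "y j \<le> t" if "j \<in> A" "y j < ereal x" for j
      unfolding t_def by (rule Max_ge) (use fin' that in auto)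
    then have "(\<Sum>j\<in>A. p j * (if y j < ereal x then 1 else 0))
        \<le> (\<Sum>j\<in>A. p j * (if y j \<le> t then 1 else 0))"
      by (intro sum_mono mult_left_mono) (auto simp: p)
    with ge have "a \<le> (\<Sum>j\<in>A. p j * (if y j \<le> t then 1 else 0))" by simp
    then have "quantile a (\<lambda>t. \<Sum>j\<in>A. p j * (if y j \<le> t then 1 else 0)) \<le> t"
      unfolding quantile_def by (intro Inf_lower) simp
    with le tx show False by simp
  qed
next
  assume less: "(\<Sum>j\<in>A. p j * (if y j < ereal x then 1 else 0)) < a"
  show "ereal x \<le> quantile a (\<lambda>t. \<Sum>j\<in>A. p j * (if y j \<le> t then 1 else 0))"
    unfolding quantile_def
  proof (rule Inf_greatest, rule ccontr)
    fix t assume t: "t \<in> {t. a \<le> (\<Sum>j\<in>A. p j * (if y j \<le> t then 1 else 0))}" and "\<not> ereal x \<le> t"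
    then have "(\<Sum>j\<in>A. p j * (if y j \<le> t then 1 else 0)) \<le> (\<Sum>j\<in>A. p j * (if y j < ereal x then 1 else 0))"
      by (intro sum_mono mult_left_mono) (auto simp: p)
    with less t show False by simp
  qed
qed

lemma sum_locH_pos:
  fixes X :: "nat \<Rightarrow> 'x"
  shows "0 < (\<Sum>k=1..n+1. locH d hb (X i) (X k))"
  by (intro sum_pos) (auto simp: locH_def)

lemma pH_pos: "0 < pH d hb n X i j"
  unfolding pH_def using sum_locH_pos by (intro divide_pos_pos) (auto simp: locH_def)

lemma sum_pH: "(\<Sum>j=1..n+1. pH d hb n X i j) = 1"
  using sum_locH_pos[of d hb X i n] by (simp add: pH_def flip: sum_divide_distrib)

lemma le_quantile_Fi_cdf_iff:
  "ereal ((Vs(n+1 := v)) i) \<le> quantile a (Fi_cdf d hb n X Vs i v)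
     \<longleftrightarrow> wrank d hb n X (Vs(n+1 := v)) i < a"
proof -
  have "Fi_cdf d hb n X Vs i v
      = (\<lambda>t. \<Sum>j=1..n+1. pH d hb n X i j * (if ereal ((Vs(n+1 := v)) j) \<le> t then 1 else 0))"
    by (rule ext) (auto simp: Fi_cdf_def intro!: sum.cong)
  then show ?thesis
    by (simp only: wrank_def le_quantile_step_iff[OF finite_atLeastAtMost pH_pos[THEN less_imp_le]] less_ereal.simps)
qed

text \<open>Strict comparison with \<open>v\<close> gives 0 at the test point whether its mass sits
  at \<open>\<infinity>\<close> or at \<open>v\<close>. Hence the test distribution and row
  \<open>n+1\<close> of the calibration share one rank.\<close>

lemma le_quantile_Ftest_cdf_iff:
  "ereal v \<le> quantile a (Ftest_cdf d hb n X Vs) \<longleftrightarrow> wrank d hb n X (Vs(n+1 := v)) (n+1) < a"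
proof -
  let ?y = "(\<lambda>j. ereal (Vs j))(n+1 := \<infinity>)"
  have "Ftest_cdf d hb n X Vs = (\<lambda>t. \<Sum>j=1..n+1. pH d hb n X (n+1) j * (if ?y j \<le> t then 1 else 0))"
    by (rule ext) (auto simp: Ftest_cdf_def intro!: sum.cong)
  moreover have "(\<Sum>j=1..n+1. pH d hb n X (n+1) j * (if ?y j < ereal v then 1 else 0))
      = wrank d hb n X (Vs(n+1 := v)) (n+1)"
    unfolding wrank_def by (auto intro!: sum.cong)
  ultimately show ?thesis
    by (simp only: le_quantile_step_iff[OF finite_atLeastAtMost pH_pos[THEN less_imp_le]])
qed

section \<open>The calibrated level as a minimum over finitely many candidates\<close>

lemma finite_Gamma_set: "finite (Gamma_set d hb n X)"
proof -
  have "Gamma_set d hb n X = (\<lambda>(i, I). \<Sum>k\<in>I. pH d hb n X i k) ` ({1..n+1} \<times> Pow {1..n+1})"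
    unfolding Gamma_set_def by (auto simp del: add_Suc_right One_nat_def simp: image_iff) blast
  then show ?thesis by simp
qed

lemma alpha_tilde_eq:
  "alpha_tilde d hb n X Vs \<alpha> v
     = Min {a \<in> Gamma_set d hb n X. coverage_ok d hb n X (Vs(n+1 := v)) \<alpha> a}"
  unfolding alpha_tilde_def coverage_ok_def le_quantile_Fi_cdf_iff
  by (simp add: field_simps del: sum.cl_ivl_Suc)

text \<open>A row never counts its own weight, and that weight is positive.\<close>

lemma wrank_less_1: "i \<in> {1..n+1} \<Longrightarrow> wrank d hb n X W i < 1"
proof -
  assume i: "i \<in> {1..n+1}"
  have "wrank d hb n X W i < (\<Sum>j=1..n+1. pH d hb n X i j)"
    unfolding wrank_def
    by (rule sum_strict_mono_ex1) (use i in \<open>auto intro!: bexI[of _ i] simp: pH_pos less_imp_le\<close>)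
  then show ?thesis by (simp only: sum_pH)
qed

lemma wrank_in_Gamma_set:
  assumes "i \<in> {1..n+1}" shows "wrank d hb n X W i \<in> Gamma_set d hb n X"
proof -
  have "wrank d hb n X W i = (\<Sum>j\<in>{j\<in>{1..n+1}. W j < W i}. pH d hb n X i j)"
    unfolding wrank_def by (subst sum.inter_filter) (auto intro!: sum.cong)
  then show ?thesis using assms unfolding Gamma_set_def by blast
qed

text \<open>Ensures that the minimum defining \<open>alpha_tilde\<close> is over a nonempty set: 1
  is a full row sum, and all ranks lie strictly below it.\<close>

lemma coverage_ok_1:
  assumes "\<alpha> \<le> 1" shows "1 \<in> Gamma_set d hb n X \<and> coverage_ok d hb n X W \<alpha> 1"
proof
  have "1 = (\<Sum>j=1..n+1. pH d hb n X 1 j)" using sum_pH by metis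
  moreover have "(1::nat) \<in> {1..n+1}" by simp
  ultimately show "1 \<in> Gamma_set d hb n X" unfolding Gamma_set_def by blast
  have "(\<Sum>i=1..n+1. if wrank d hb n X W i < 1 then 1 else 0) = (\<Sum>i=1..n+1. 1::real)"
    by (intro sum.cong refl) (simp add: wrank_less_1)
  then show "coverage_ok d hb n X W \<alpha> 1"
    unfolding coverage_ok_def using assms mult_right_mono[of \<alpha> 1 "real (n+1)"] by simp
qed

text \<open>Trades \<open>Min\<close> for a quantifier over \<open>Gamma_set\<close>, the form used
  both for the estimates and for measurability.\<close>

lemma alpha_tilde_less_iff:
  assumes "\<alpha> \<le> 1"
  shows "alpha_tilde d hb n X Vs \<alpha> v < b \<longleftrightarrow>
    (\<exists>a\<in>Gamma_set d hb n X. coverage_ok d hb n X (Vs(n+1 := v)) \<alpha> a \<and> a < b)"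
  unfolding alpha_tilde_eq
  by (subst Min_less_iff) (use coverage_ok_1[OF assms, of d hb n X] in \<open>auto simp: finite_Gamma_set\<close>)

lemma less_alpha_tilde_iff:
  assumes "\<alpha> \<le> 1"
  shows "b < alpha_tilde d hb n X Vs \<alpha> v \<longleftrightarrow>
    (\<forall>a\<in>Gamma_set d hb n X. coverage_ok d hb n X (Vs(n+1 := v)) \<alpha> a \<longrightarrow> b < a)"
  unfolding alpha_tilde_eq
  by (subst Min_gr_iff) (use coverage_ok_1[OF assms, of d hb n X] in \<open>auto simp: finite_Gamma_set\<close>)

lemma alpha_tilde_in_Gamma_set:
  assumes "\<alpha> \<le> 1" shows "alpha_tilde d hb n X Vs \<alpha> v \<in> Gamma_set d hb n X"
proof -
  have "alpha_tilde d hb n X Vs \<alpha> v \<in> {a \<in> Gamma_set d hb n X. coverage_ok d hb n X (Vs(n+1 := v)) \<alpha> a}"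
    unfolding alpha_tilde_eq
    by (rule Min_in) (use coverage_ok_1[OF assms, of d hb n X] in \<open>auto simp: finite_Gamma_set\<close>)
  then show ?thesis by simp
qed

lemma mem_C_V_iff:
  assumes "\<alpha> \<le> 1"
  shows "v \<in> C_V d hb n X Vs \<alpha> \<longleftrightarrow>
    (\<forall>a\<in>Gamma_set d hb n X. coverage_ok d hb n X (Vs(n+1 := v)) \<alpha> a
       \<longrightarrow> wrank d hb n X (Vs(n+1 := v)) (n+1) < a)"
  by (simp only: C_V_def mem_Collect_eq le_quantile_Ftest_cdf_iff less_alpha_tilde_iff[OF assms])

text \<open>All values of \<open>alpha_tilde\<close> lie in the finite \<open>Gamma_set\<close>. So
  the range is finite although \<open>v\<close> runs over the reals, and \<open>Max\<close> is a
  true maximum.\<close>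

lemma Max_alpha_tilde_less_iff:
  assumes "\<alpha> \<le> 1"
  shows "Max (range (\<lambda>v. \<bar>alpha_tilde d hb n X Vs \<alpha> v - \<alpha>\<bar>)) < \<epsilon> \<longleftrightarrow>
    (\<forall>v. \<bar>alpha_tilde d hb n X Vs \<alpha> v - \<alpha>\<bar> < \<epsilon>)"
proof -
  have "range (\<lambda>v. \<bar>alpha_tilde d hb n X Vs \<alpha> v - \<alpha>\<bar>) \<subseteq> (\<lambda>a. \<bar>a - \<alpha>\<bar>) ` Gamma_set d hb n X"
    using alpha_tilde_in_Gamma_set[OF assms] by (auto intro!: imageI)
  then have "finite (range (\<lambda>v. \<bar>alpha_tilde d hb n X Vs \<alpha> v - \<alpha>\<bar>))"
    using finite_Gamma_set finite_subset by blast
  then show ?thesis by (subst Max_less_iff) auto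
qed

section \<open>Reduction to countably many imputed scores\<close>

lemma wrank_cong_order:
  assumes "\<And>j k. j \<in> {1..n+1} \<Longrightarrow> k \<in> {1..n+1} \<Longrightarrow> W j < W k \<longleftrightarrow> W' j < W' k" "i \<in> {1..n+1}"
  shows "wrank d hb n X W i = wrank d hb n X W' i"
  unfolding wrank_def by (rule sum.cong) (use assms in auto)

lemma alpha_tilde_cong_order:
  assumes "\<And>j. j \<in> {1..n} \<Longrightarrow> Vs j < v \<longleftrightarrow> Vs j < v'" "\<And>j. j \<in> {1..n} \<Longrightarrow> v < Vs j \<longleftrightarrow> v' < Vs j"
  shows "alpha_tilde d hb n X Vs \<alpha> v = alpha_tilde d hb n X Vs \<alpha> v'"
proof -
  have "wrank d hb n X (Vs(n+1 := v)) i = wrank d hb n X (Vs(n+1 := v')) i" if "i \<in> {1..n+1}" for i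
    by (rule wrank_cong_order[OF _ that]) (auto simp: assms le_Suc_eq)
  then have "coverage_ok d hb n X (Vs(n+1 := v)) \<alpha> a = coverage_ok d hb n X (Vs(n+1 := v')) \<alpha> a" for a
    unfolding coverage_ok_def by (intro arg_cong2[where f = "(\<le>)"] sum.cong refl) simp
  then show ?thesis unfolding alpha_tilde_eq by simp
qed

text \<open>Immediately to the right of \<open>v\<close> lies an interval free of scores; any
  rational in it compares with the scores as \<open>v\<close> does.\<close>

lemma ex_Rat_same_order:
  fixes Vs :: "nat \<Rightarrow> real"
  assumes "finite J" "v \<notin> Vs ` J"
  obtains q where "q \<in> \<rat>" "\<And>j. j \<in> J \<Longrightarrow> Vs j < v \<longleftrightarrow> Vs j < q" "\<And>j. j \<in> J \<Longrightarrow> v < Vs j \<longleftrightarrow> q < Vs j"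
proof -
  \<comment> \<open>The element \<open>v + 1\<close> keeps the set nonempty when no score exceeds
    \<open>v\<close>.\<close>
  define u where "u = Min (insert (v + 1) {Vs j | j. j \<in> J \<and> v < Vs j})"
  have fin: "finite (insert (v + 1) {Vs j | j. j \<in> J \<and> v < Vs j})" using assms by auto
  have "u \<in> insert (v + 1) {Vs j | j. j \<in> J \<and> v < Vs j}" unfolding u_def by (rule Min_in) (use fin in auto)
  then have "v < u" by auto
  then obtain q where q: "q \<in> \<rat>" "v < q" "q < u" using Rats_dense_in_real by blast
  have u: "u \<le> Vs j" if "j \<in> J" "v < Vs j" for j
    unfolding u_def by (rule Min_le) (use fin that in auto)
  have ne: "Vs j \<noteq> v" if "j \<in> J" for j using assms that by auto
  show ?thesis
  proof (rule that[OF q(1)])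
    fix j assume j: "j \<in> J"
    show "Vs j < v \<longleftrightarrow> Vs j < q" using u[OF j] ne[OF j] q by force
    show "v < Vs j \<longleftrightarrow> q < Vs j" using u[OF j] ne[OF j] q by force
  qed
qed

text \<open>The level depends on \<open>v\<close> only through its order position among the scores,
  so the rationals and the scores themselves (for ties) represent every case. A quantifier over the
  reals becomes a countable one, as measurability requires.\<close>

lemma all_alpha_tilde_iff:
  "(\<forall>v. P (alpha_tilde d hb n X Vs \<alpha> v)) \<longleftrightarrow>
   (\<forall>q. P (alpha_tilde d hb n X Vs \<alpha> (of_rat q))) \<and> (\<forall>j\<in>{1..n}. P (alpha_tilde d hb n X Vs \<alpha> (Vs j)))"
proof (intro iffI allI)
  fix v assume *: "(\<forall>q. P (alpha_tilde d hb n X Vs \<alpha> (of_rat q))) \<and> (\<forall>j\<in>{1..n}. P (alpha_tilde d hb n X Vs \<alpha> (Vs j)))"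
  show "P (alpha_tilde d hb n X Vs \<alpha> v)"
  proof (cases "v \<in> Vs ` {1..n}")
    case False
    obtain q where q: "q \<in> \<rat>" "\<And>j. j \<in> {1..n} \<Longrightarrow> Vs j < v \<longleftrightarrow> Vs j < q" "\<And>j. j \<in> {1..n} \<Longrightarrow> v < Vs j \<longleftrightarrow> q < Vs j"
      using ex_Rat_same_order[OF _ False] by blast
    from q(1) obtain r where "q = of_rat r" by (rule Rats_cases)
    with * alpha_tilde_cong_order[of n Vs v q d hb X \<alpha>] q(2,3) show ?thesis by simp
  qed (use * in auto)
qed auto

text \<open>The slack 2 absorbs the weights of row \<open>i\<close> on itself and on the test point, so the
  conclusion holds whatever score is imputed at the test point.\<close>

lemma wrank_near:
  fixes w :: real
  assumes d0: "\<forall>a b. 0 \<le> d a b" "\<forall>a. d a a = 0" and hb: "0 < hb" and i: "i \<in> {1..n+1}"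
    and w: "0 \<le> w" "w \<le> 1" and e: "0 < e"
    and up: "(\<Sum>j\<in>{1..n}-{i}. locH d hb (X i) (X j) * ((if W j < W i then 1 else 0) - w - e)) < -2"
    and lo: "(\<Sum>j\<in>{1..n}-{i}. locH d hb (X i) (X j) * (w - e - (if W j < W i then 1 else 0))) < -2"
  shows "\<bar>wrank d hb n X W i - w\<bar> < e"
proof -
  let ?H = "\<lambda>j. locH d hb (X i) (X j)"
  let ?I = "\<lambda>j. if W j < W i then 1 else 0 :: real"
  have H: "0 < ?H j" "?H j \<le> 1" for j
    using d0 hb by (auto simp: locH_def intro!: divide_nonneg_pos)
  define D where "D = {1..n}-{i}"
  \<comment> \<open>The row itself and the test point, which coincide when \<open>i = n+1\<close>;
    this is why \<open>subR\<close> below is only an inequality.\<close>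
  define R where "R = {1..n+1} - D"
  have R: "R \<subseteq> {i, n+1}" "finite R" "i \<in> R" using i unfolding R_def D_def by (auto simp: le_Suc_eq)
  have Iiz: "?I i = 0" by simp
  have split: "(\<Sum>j=1..n+1. f j) = (\<Sum>j\<in>D. f j) + (\<Sum>j\<in>R. f j)" for f :: "nat \<Rightarrow> real"
    unfolding R_def by (rule sum.subset_diff[OF _ finite_atLeastAtMost, THEN trans, OF _ add.commute]) (auto simp: D_def)
  have subR: "(\<Sum>j\<in>R. f j) \<le> f i + f (n+1)" if "\<And>j. 0 \<le> f j" for f :: "nat \<Rightarrow> real"
  proof -
    have "(\<Sum>j\<in>R. f j) \<le> (\<Sum>j\<in>{i, n+1}. f j)" by (rule sum_mono2) (use R that in auto)
    also have "\<dots> \<le> f i + f (n+1)" using that by (cases "i = n+1") auto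
    finally show ?thesis .
  qed
  define A B S where "A = (\<Sum>j\<in>D. ?H j * ?I j)" and "B = (\<Sum>j\<in>D. ?H j)" and "S = (\<Sum>j=1..n+1. ?H j)"
  define a b where "a = (\<Sum>j\<in>R. ?H j * ?I j)" and "b = (\<Sum>j\<in>R. ?H j)"
  have S: "S = B + b" "0 < S" unfolding S_def B_def b_def split[symmetric] using sum_locH_pos by auto
  have wr: "wrank d hb n X W i = (A + a) / S"
    unfolding wrank_def pH_def A_def a_def split[symmetric] S_def
    by (simp add: sum_divide_distrib del: sum.cl_ivl_Suc)
  have a: "0 \<le> a" unfolding a_def using H by (intro sum_nonneg) (auto intro: less_imp_le)
  have "a \<le> ?H i * ?I i + ?H (n+1) * ?I (n+1)" unfolding a_def by (rule subR) (use H in \<open>auto intro: less_imp_le\<close>)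
  also have "\<dots> \<le> 1" using H(2)[of "n+1"] by auto
  finally have a1: "a \<le> 1" .
  have b: "0 \<le> b" unfolding b_def using H by (intro sum_nonneg) (auto intro: less_imp_le)
  have "b \<le> ?H i + ?H (n+1)" unfolding b_def by (rule subR) (use H in \<open>auto intro: less_imp_le\<close>)
  also have "\<dots> \<le> 2" using H(2)[of "n+1"] H(2)[of i] by auto
  finally have b2: "b \<le> 2" .
  have up': "A - (w + e) * B < -2"
    using up unfolding A_def B_def D_def[symmetric] by (simp add: sum_subtractf sum_distrib_left algebra_simps flip: sum.distrib)
  have lo': "(w - e) * B - A < -2"
    using lo unfolding A_def B_def D_def[symmetric] by (simp add: sum_subtractf sum_distrib_left algebra_simps flip: sum.distrib)
  \<comment> \<open>The slack 2 in \<open>up'\<close> and \<open>lo'\<close> pays for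
    \<open>R\<close>: there the counted weight \<open>a\<close> is at most 1, because row
    \<open>i\<close> does not count itself, and the total weight \<open>b\<close> is at most
    2.\<close>
  have "0 \<le> (w + e) * b" using b w e by simp
  then have "A + a < (w + e) * S" using up' a1 S by (simp add: algebra_simps)
  moreover have "(w - e) * b \<le> 2"
  proof -
    have "(w - e) * b \<le> 1 * b" using b w e by (intro mult_right_mono) auto
    with b2 show ?thesis by simp
  qed
  then have "(w - e) * S < A + a" using lo' a S by (simp add: algebra_simps)
  ultimately have "(A + a) / S < w + e" "w - e < (A + a) / S" using S(2) by (simp_all add: field_simps)
  then show ?thesis unfolding wr by linarith
qed

text \<open>The level is confined to the discrete set \<open>Gamma_set\<close>, so an upper bound
  needs an actual candidate: \<open>gap\<close> supplies a row whose rank is one. For the lower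
  bound, a level at or below \<open>\<alpha> - e\<close> covers too few rows. Closeness is assumed
  only for rows up to \<open>n\<close>, since the imputed \<open>v\<close> is arbitrary.\<close>

lemma alpha_tilde_near:
  fixes w :: "nat \<Rightarrow> real"
  assumes \<alpha>: "\<alpha> \<le> 1" and e: "0 < e"
    and near: "\<And>i. i \<in> {1..n} \<Longrightarrow> \<bar>wrank d hb n X (Vs(n+1 := v)) i - w i\<bar> < e / 8"
    and up: "\<alpha> * real (n+1) \<le> (\<Sum>i=1..n. if w i < \<alpha> + e / 4 then 1 else 0)"
    and gap: "\<exists>i\<in>{1..n}. \<alpha> + 5 * e / 8 \<le> w i \<and> w i < \<alpha> + 7 * e / 8"
    and lo: "(\<Sum>i=1..n. if w i < \<alpha> - e / 2 then 1 else 0) + 1 < \<alpha> * real (n+1)"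
  shows "\<bar>alpha_tilde d hb n X Vs \<alpha> v - \<alpha>\<bar> < e"
proof -
  let ?U = "wrank d hb n X (Vs(n+1 := v))"
  obtain k where k: "k \<in> {1..n}" "\<alpha> + 5 * e / 8 \<le> w k" "w k < \<alpha> + 7 * e / 8" using gap by blast
  \<comment> \<open>With errors below \<open>e/8\<close>, the rows counted on the left have rank
    below \<open>\<alpha> + 3*e/8\<close>, while \<open>?U k\<close> exceeds
    \<open>\<alpha> + e/2\<close>.\<close>
  have "(\<Sum>i=1..n. if w i < \<alpha> + e / 4 then 1 else 0) \<le> (\<Sum>i=1..n. if ?U i < ?U k then 1 else 0 :: real)"
  proof (rule sum_mono)
    fix i assume "i \<in> {1..n}"
    then show "(if w i < \<alpha> + e / 4 then 1 else 0) \<le> (if ?U i < ?U k then 1 else 0 :: real)"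
      using near[of i] near[of k] k e by (auto simp: abs_real_def split: if_splits)
  qed
  also have "\<dots> \<le> (\<Sum>i=1..n+1. if ?U i < ?U k then 1 else 0)" by simp
  finally have "coverage_ok d hb n X (Vs(n+1 := v)) \<alpha> (?U k)" using up unfolding coverage_ok_def by linarith
  moreover have "?U k < \<alpha> + e" using near[OF k(1)] k(3) by linarith
  moreover have "?U k \<in> Gamma_set d hb n X" using k(1) by (intro wrank_in_Gamma_set) auto
  ultimately have "alpha_tilde d hb n X Vs \<alpha> v < \<alpha> + e" unfolding alpha_tilde_less_iff[OF \<alpha>] by blast
  moreover have "\<alpha> - e < alpha_tilde d hb n X Vs \<alpha> v"
    unfolding less_alpha_tilde_iff[OF \<alpha>]
  proof (intro ballI impI, rule ccontr)
    fix a assume ok: "coverage_ok d hb n X (Vs(n+1 := v)) \<alpha> a" and "\<not> \<alpha> - e < a"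
    then have a: "a \<le> \<alpha> - e" by simp
    \<comment> \<open>Row \<open>n+1\<close> is not controlled and is charged its largest
      contribution 1, the source of the \<open>+ 1\<close> in \<open>lo\<close>.\<close>
    have "(\<Sum>i=1..n+1. if ?U i < a then 1 else 0) \<le> (\<Sum>i=1..n. if ?U i < a then 1 else 0) + (1::real)" by simp
    also have "(\<Sum>i=1..n. if ?U i < a then 1 else 0) \<le> (\<Sum>i=1..n. if w i < \<alpha> - e / 2 then 1 else 0 :: real)"
    proof (rule sum_mono)
      fix i assume "i \<in> {1..n}"
      then show "(if ?U i < a then 1 else 0) \<le> (if w i < \<alpha> - e / 2 then 1 else 0 :: real)"
        using near[of i] a e by (auto simp: abs_real_def split: if_splits)
    qed
    finally show False using ok lo unfolding coverage_ok_def by linarith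
  qed
  ultimately show ?thesis by linarith
qed

subsection \<open>Measurability of the calibrated level\<close>

text \<open>\<open>Gamma_set\<close> varies with the sample, but the index pairs
  \<open>(i, I)\<close> range over a fixed finite set, so measurability passes through finite
  conjunctions and disjunctions.\<close>

lemma ball_Gamma_set:
  "(\<forall>a\<in>Gamma_set d hb n X. P a) \<longleftrightarrow> (\<forall>i\<in>{1..n+1}. \<forall>I\<in>Pow {1..n+1}. P (\<Sum>k\<in>I. pH d hb n X i k))"
  unfolding Gamma_set_def by blast

lemma bex_Gamma_set:
  "(\<exists>a\<in>Gamma_set d hb n X. P a) \<longleftrightarrow> (\<exists>i\<in>{1..n+1}. \<exists>I\<in>Pow {1..n+1}. P (\<Sum>k\<in>I. pH d hb n X i k))"
  unfolding Gamma_set_def by blast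

context
  fixes M :: "'w measure" and d :: "'x::second_countable_topology \<Rightarrow> 'x \<Rightarrow> real" and X :: "'w \<Rightarrow> nat \<Rightarrow> 'x" and Vs :: "'w \<Rightarrow> nat \<Rightarrow> real"
    and n :: nat
  assumes d_meas: "(\<lambda>(a, b). d a b) \<in> borel_measurable (borel \<Otimes>\<^sub>M borel)"
    and X_meas: "\<And>i. i \<in> {1..n+1} \<Longrightarrow> (\<lambda>\<omega>. X \<omega> i) \<in> borel_measurable M"
    and Vs_meas: "\<And>i. i \<in> {1..n+1} \<Longrightarrow> (\<lambda>\<omega>. Vs \<omega> i) \<in> borel_measurable M"
begin

lemma measurable_pH:
  assumes "i \<in> {1..n+1}" "j \<in> {1..n+1}"
  shows "(\<lambda>\<omega>. pH d hb n (X \<omega>) i j) \<in> borel_measurable M"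
proof -
  have d_X: "(\<lambda>\<omega>. d (X \<omega> i) (X \<omega> j)) \<in> borel_measurable M" if "i \<in> {1..n+1}" "j \<in> {1..n+1}" for i j
    using measurable_compose[OF measurable_Pair[OF X_meas[OF that(1)] X_meas[OF that(2)]] d_meas] by simp
  have locH_X: "(\<lambda>\<omega>. locH d hb (X \<omega> i) (X \<omega> j)) \<in> borel_measurable M" if "i \<in> {1..n+1}" "j \<in> {1..n+1}" for i j
    unfolding locH_def
    by (intro borel_measurable_exp[THEN measurable_compose[rotated]] borel_measurable_divide
        borel_measurable_uminus borel_measurable_const d_X that)
  show ?thesis unfolding pH_def
    by (intro borel_measurable_divide borel_measurable_sum locH_X assms)
qed

lemma measurable_wrank:
  assumes "v \<in> borel_measurable M" "i \<in> {1..n+1}"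
  shows "(\<lambda>\<omega>. wrank d hb n (X \<omega>) ((Vs \<omega>)(n+1 := v \<omega>)) i) \<in> borel_measurable M"
proof -
  have W: "(\<lambda>\<omega>. ((Vs \<omega>)(n+1 := v \<omega>)) i) \<in> borel_measurable M" if "i \<in> {1..n+1}" for i
    using assms(1) Vs_meas[OF that] by (cases "i = n+1") auto
  have "{\<omega> \<in> space M. ((Vs \<omega>)(n+1 := v \<omega>)) j < ((Vs \<omega>)(n+1 := v \<omega>)) i} \<in> sets M" if "j \<in> {1..n+1}" for j
    by (rule borel_measurable_less[OF W[OF that] W[OF assms(2)]])
  then show ?thesis unfolding wrank_def
    by (intro borel_measurable_sum borel_measurable_times measurable_pH assms measurable_If
        borel_measurable_const)
qed

lemma measurable_coverage_ok:
  assumes [measurable]: "v \<in> borel_measurable M" "a \<in> borel_measurable M"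
  shows "Measurable.pred M (\<lambda>\<omega>. coverage_ok d hb n (X \<omega>) ((Vs \<omega>)(n+1 := v \<omega>)) \<alpha> (a \<omega>))"
  unfolding coverage_ok_def
proof -
  have "(\<lambda>\<omega>. \<Sum>i=1..n+1. if wrank d hb n (X \<omega>) ((Vs \<omega>)(n+1 := v \<omega>)) i < a \<omega> then 1 else 0 :: real)
      \<in> borel_measurable M"
    by (intro borel_measurable_sum measurable_If measurable_const borel_measurable_less measurable_wrank assms) auto
  then show "Measurable.pred M (\<lambda>\<omega>. \<alpha> * real (n+1)
      \<le> (\<Sum>i=1..n+1. if wrank d hb n (X \<omega>) ((Vs \<omega>)(n+1 := v \<omega>)) i < a \<omega> then 1 else 0))"
    by (simp only: borel_measurable_const borel_measurable_le pred_def)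
qed

lemma measurable_Gamma_sum:
  assumes "i \<in> {1..n+1}" "I \<in> Pow {1..n+1}"
  shows "(\<lambda>\<omega>. \<Sum>k\<in>I. pH d hb n (X \<omega>) i k) \<in> borel_measurable M"
  using assms by (intro borel_measurable_sum measurable_pH) auto

lemma measurable_ex_Gamma_set:
  assumes "\<And>i I. i \<in> {1..n+1} \<Longrightarrow> I \<in> Pow {1..n+1} \<Longrightarrow> Measurable.pred M (\<lambda>\<omega>. P \<omega> (\<Sum>k\<in>I. pH d hb n (X \<omega>) i k))"
  shows "Measurable.pred M (\<lambda>\<omega>. \<exists>a\<in>Gamma_set d hb n (X \<omega>). P \<omega> a)"
  unfolding bex_Gamma_set by (intro pred_intros_finite(4) finite_atLeastAtMost finite_Pow_iff[THEN iffD2] assms)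

lemma measurable_all_Gamma_set:
  assumes "\<And>i I. i \<in> {1..n+1} \<Longrightarrow> I \<in> Pow {1..n+1} \<Longrightarrow> Measurable.pred M (\<lambda>\<omega>. P \<omega> (\<Sum>k\<in>I. pH d hb n (X \<omega>) i k))"
  shows "Measurable.pred M (\<lambda>\<omega>. \<forall>a\<in>Gamma_set d hb n (X \<omega>). P \<omega> a)"
  unfolding ball_Gamma_set by (intro pred_intros_finite(3) finite_atLeastAtMost finite_Pow_iff[THEN iffD2] assms)

lemma measurable_alpha_tilde_near:
  assumes "\<alpha> \<le> 1" "v \<in> borel_measurable M"
  shows "Measurable.pred M (\<lambda>\<omega>. \<bar>alpha_tilde d hb n (X \<omega>) (Vs \<omega>) \<alpha> (v \<omega>) - \<alpha>\<bar> < \<epsilon>)"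
proof -
  have *: "\<bar>x - \<alpha>\<bar> < \<epsilon> \<longleftrightarrow> x < \<alpha> + \<epsilon> \<and> \<alpha> - \<epsilon> < x" for x :: real by linarith
  show ?thesis
    unfolding * alpha_tilde_less_iff[OF assms(1)] less_alpha_tilde_iff[OF assms(1)]
    apply (rule pred_intros_logic(3))
    subgoal by (rule measurable_ex_Gamma_set, rule pred_intros_logic(3), rule measurable_coverage_ok[OF assms(2)])
       (auto intro!: measurable_Gamma_sum borel_measurable_less simp: pred_def)
    subgoal by (rule measurable_all_Gamma_set, rule pred_intros_logic(4), rule measurable_coverage_ok[OF assms(2)])
       (auto intro!: measurable_Gamma_sum borel_measurable_less simp: pred_def)
    done
qed

lemma measurable_Max_alpha_tilde:
  assumes "\<alpha> \<le> 1"
  shows "Measurable.pred M (\<lambda>\<omega>. Max (range (\<lambda>v. \<bar>alpha_tilde d hb n (X \<omega>) (Vs \<omega>) \<alpha> v - \<alpha>\<bar>)) < \<epsilon>)"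
  unfolding Max_alpha_tilde_less_iff[OF assms] all_alpha_tilde_iff[where P = "\<lambda>a. \<bar>a - \<alpha>\<bar> < \<epsilon>"]
  by (intro pred_intros_logic(3) pred_intros_countable(1) pred_intros_finite(3)[OF finite_atLeastAtMost]
      measurable_alpha_tilde_near assms measurable_const Vs_meas) auto

lemma measurable_mem_C_V:
  assumes "\<alpha> \<le> 1" "v \<in> borel_measurable M"
  shows "Measurable.pred M (\<lambda>\<omega>. v \<omega> \<in> C_V d hb n (X \<omega>) (Vs \<omega>) \<alpha>)"
  unfolding mem_C_V_iff[OF assms(1)]
  by (rule measurable_all_Gamma_set, rule pred_intros_logic(4), rule measurable_coverage_ok[OF assms(2)])
    (auto intro!: measurable_Gamma_sum measurable_wrank[OF assms(2)] borel_measurable_less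
      simp: pred_def simp del: One_nat_def add_Suc_right)

end

subsection \<open>Exponential bounds and the probability integral transform\<close>

lemma exp_le_quadratic:
  fixes y :: real assumes "\<bar>y\<bar> \<le> 1 / 2" shows "exp y \<le> 1 + y + y\<^sup>2"
proof (cases "0 \<le> y")
  case True then show ?thesis using exp_bound[of y] assms by simp
next
  case False
  define x where "x = - y"
  have x: "0 \<le> x" "x \<le> 1 / 2" using False assms by (auto simp: x_def)
  \<comment> \<open>The product is 1 plus the cube of \<open>x\<close>.\<close>
  have "1 \<le> (1 - x + x\<^sup>2) * (1 + x)"
    using x by (simp add: algebra_simps power2_eq_square)
  also have "\<dots> \<le> (1 - x + x\<^sup>2) * exp x"
    using x by (intro mult_left_mono) (auto simp: add_nonneg_nonneg)
  finally have "exp (- x) \<le> 1 - x + x\<^sup>2" by (simp add: exp_minus field_simps)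
  then show ?thesis by (simp add: x_def)
qed

text \<open>From \<open>|T| \<le> 2 * g\<close> and \<open>g \<le> 1\<close> follows
  \<open>T\<^sup>2 \<le> 4 * g\<close>, so the second moment is controlled by the mean of
  \<open>g\<close> and not merely by a constant. This matters when that mean is small, as for
  localized weights with a shrinking bandwidth.\<close>

lemma (in prob_space) nn_integral_exp_drift_le:
  fixes T g :: "'a \<Rightarrow> real"
  assumes [measurable]: "T \<in> borel_measurable M" "g \<in> borel_measurable M"
    and g: "\<And>x. 0 \<le> g x" "\<And>x. g x \<le> 1" and T: "\<And>x. \<bar>T x\<bar> \<le> 2 * g x"
    and \<kappa>: "0 \<le> \<kappa>" "\<kappa> \<le> 2" and drift: "expectation T \<le> - \<kappa> * expectation g"
  shows "(\<integral>\<^sup>+x. ennreal (exp (\<kappa> / 8 * T x)) \<partial>M) \<le> ennreal (exp (- (\<kappa>\<^sup>2 / 16) * expectation g))"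
proof -
  \<comment> \<open>This value minimizes \<open>4 * l\<^sup>2 - \<kappa> * l\<close>, with minimum
    \<open>- \<kappa>\<^sup>2 / 16\<close>; \<open>\<kappa> \<le> 2\<close> keeps
    \<open>|l * T x|\<close> within the range of \<open>exp_le_quadratic\<close>.\<close>
  define l where "l = \<kappa> / 8"
  have l: "0 \<le> l" "l \<le> 1 / 4" using \<kappa> by (auto simp: l_def)
  have T2: "\<bar>T x\<bar> \<le> 2" for x using T[of x] g(2)[of x] by linarith
  have intT: "integrable M T" by (rule integrable_const_bound[where B = 2]) (use T2 in auto)
  have intg: "integrable M g" by (rule integrable_const_bound[where B = 1]) (use g in auto)
  have pt: "exp (l * T x) \<le> 1 + l * T x + 4 * l\<^sup>2 * g x" for x
  proof -
    have "\<bar>l * T x\<bar> \<le> 1 / 4 * 2" unfolding abs_mult by (intro mult_mono) (use l T2 in auto)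
    then have "exp (l * T x) \<le> 1 + l * T x + (l * T x)\<^sup>2" by (intro exp_le_quadratic) simp
    moreover have "(T x)\<^sup>2 \<le> 4 * g x"
    proof -
      have "\<bar>T x\<bar> * \<bar>T x\<bar> \<le> (2 * g x) * 2" by (intro mult_mono) (use T T2 g in auto)
      then show ?thesis by (simp add: power2_eq_square)
    qed
    then have "(l * T x)\<^sup>2 \<le> l\<^sup>2 * (4 * g x)" unfolding power_mult_distrib by (intro mult_left_mono) auto
    ultimately show ?thesis by simp
  qed
  have int: "integrable M (\<lambda>x. 1 + l * T x + 4 * l\<^sup>2 * g x)" using intT intg by auto
  have "(\<integral>\<^sup>+x. ennreal (exp (l * T x)) \<partial>M) \<le> (\<integral>\<^sup>+x. ennreal (1 + l * T x + 4 * l\<^sup>2 * g x) \<partial>M)"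
    by (intro nn_integral_mono ennreal_leI pt)
  also have "\<dots> = ennreal (\<integral>x. 1 + l * T x + 4 * l\<^sup>2 * g x \<partial>M)"
    by (intro nn_integral_eq_integral int AE_I2 order_trans[OF _ pt]) simp
  also have "(\<integral>x. 1 + l * T x + 4 * l\<^sup>2 * g x \<partial>M) = 1 + l * expectation T + 4 * l\<^sup>2 * expectation g"
    using intT intg by (simp add: prob_space)
  also have "\<dots> \<le> 1 + l * (- \<kappa> * expectation g) + 4 * l\<^sup>2 * expectation g"
    using drift l by (intro add_mono mult_left_mono) auto
  also have "\<dots> = 1 + (- (\<kappa>\<^sup>2 / 16) * expectation g)"
    by (simp add: l_def power2_eq_square field_simps)
  also have "\<dots> \<le> exp (- (\<kappa>\<^sup>2 / 16) * expectation g)" by (rule exp_ge_add_one_self)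
  finally show ?thesis by (simp add: l_def ennreal_leI)
qed

text \<open>Chernoff bound for a sum pairing one coordinate with the others: condition on the \<open>i\<close>-th
  coordinate, after which the summands are independent.\<close>

lemma emeasure_PiM_pair_sum_ge:
  fixes N :: "'i \<Rightarrow> 'a measure" and T :: "'a \<Rightarrow> 'a \<Rightarrow> real"
  assumes N: "\<And>j. prob_space (N j)" and sets_N: "\<And>j. sets (N j) = sets Z"
    and A: "finite A" "i \<in> A" "J \<subseteq> A - {i}" and NJ: "\<And>j. j \<in> J \<Longrightarrow> N j = Z"
    and T[measurable]: "(\<lambda>(z, z'). T z z') \<in> borel_measurable (Z \<Otimes>\<^sub>M Z)"
    and l: "0 \<le> l"
    and bound: "AE z in N i. (\<integral>\<^sup>+z'. ennreal (exp (l * T z z')) \<partial>Z) \<le> \<rho>"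
  shows "emeasure (PiM A N) {w \<in> space (PiM A N). -M \<le> (\<Sum>j\<in>J. T (w i) (w j))}
           \<le> ennreal (exp (l * M)) * \<rho> ^ card J"
proof -
  interpret product_sigma_finite N
    by unfold_locales (metis N prob_space_imp_sigma_finite sigma_finite_measure.sigma_finite_countable)
  note sets_N[measurable_cong]
  have finJ: "finite J" using A finite_subset by blast
  have A': "insert i (A - {i}) = A" using A by auto
  have [measurable]: "(\<lambda>w. w j) \<in> measurable (PiM A N) Z" if "j \<in> A" for j
    using measurable_component_singleton[OF that, of N] sets_N by (simp cong: measurable_cong_sets)
  have TA[measurable]: "(\<lambda>w. T (w i) (w j)) \<in> borel_measurable (PiM A N)" if "j \<in> J" for j
    using measurable_compose[OF measurable_Pair T, of "\<lambda>w. w i" "PiM A N" "\<lambda>w. w j"] that A by auto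
  let ?f = "\<lambda>w. ennreal (exp (l * M)) * (\<Prod>j\<in>J. ennreal (exp (l * T (w i) (w j))))"
  have f_meas: "?f \<in> borel_measurable (PiM A N)"
    by measurable
  have ev: "{w \<in> space (PiM A N). -M \<le> (\<Sum>j\<in>J. T (w i) (w j))} \<in> sets (PiM A N)" (is "?E \<in> _")
    by measurable
  have "emeasure (PiM A N) ?E = (\<integral>\<^sup>+ w. indicator ?E w \<partial>PiM A N)" using ev by simp
  also have "\<dots> \<le> (\<integral>\<^sup>+ w. ?f w \<partial>PiM A N)"
  proof (rule nn_integral_mono)
    fix w
    have "?f w = ennreal (exp (l * (M + (\<Sum>j\<in>J. T (w i) (w j)))))"
      by (simp add: prod_ennreal exp_sum[OF finJ, symmetric] sum_distrib_left distrib_left exp_add ennreal_mult'')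
    moreover have "1 \<le> exp (l * (M + (\<Sum>j\<in>J. T (w i) (w j))))" if "w \<in> ?E"
      using that l by simp
    ultimately show "indicator ?E w \<le> ?f w"
      by (auto simp: indicator_def simp flip: ennreal_1 intro!: ennreal_leI)
  qed
  also have "\<dots> = (\<integral>\<^sup>+z. (\<integral>\<^sup>+ w. ?f (w(i := z)) \<partial>(PiM (A - {i}) N)) \<partial>N i)"
    using product_nn_integral_insert_rev[of "A - {i}" i ?f, unfolded A'] f_meas A by simp
  also have "\<dots> \<le> (\<integral>\<^sup>+z. ennreal (exp (l * M)) * \<rho> ^ card J \<partial>N i)"
  proof (rule nn_integral_mono_AE, use bound AE_space in eventually_elim)
    fix z assume z: "(\<integral>\<^sup>+z'. ennreal (exp (l * T z z')) \<partial>Z) \<le> \<rho>" and zs: "z \<in> space (N i)"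
    have zs: "z \<in> space Z" using zs sets_eq_imp_space_eq[OF sets_N] by auto
    have Tz[measurable]: "T z \<in> borel_measurable Z"
      using measurable_compose[OF measurable_Pair1'[OF zs] T] by simp
    \<comment> \<open>Coordinates outside \<open>J\<close> get the factor 1, so that the product
      runs over all of \<open>A - {i}\<close> and factorizes under the product measure.\<close>
    let ?g = "\<lambda>j z'. if j \<in> J then ennreal (exp (l * T z z')) else 1"
    have prod: "(\<Prod>j\<in>J. ennreal (exp (l * T ((w(i := z)) i) ((w(i := z)) j)))) = (\<Prod>j\<in>A - {i}. ?g j (w j))" for w
    proof -
      have "(\<Prod>j\<in>A - {i}. ?g j (w j)) = (\<Prod>j\<in>J. ?g j (w j))"
        by (rule prod.mono_neutral_right) (use A in auto)
      also have "\<dots> = (\<Prod>j\<in>J. ennreal (exp (l * T ((w(i := z)) i) ((w(i := z)) j))))"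
        by (rule prod.cong) (use A in auto)
      finally show ?thesis by simp
    qed
    have g_meas: "?g j \<in> borel_measurable (N j)" for j by (cases "j \<in> J") (simp_all add: NJ)
    have "(\<integral>\<^sup>+ w. ?f (w(i := z)) \<partial>(PiM (A - {i}) N))
        = ennreal (exp (l * M)) * (\<integral>\<^sup>+ w. (\<Prod>j\<in>A - {i}. ?g j (w j)) \<partial>(PiM (A - {i}) N))"
      unfolding prod
    proof (rule nn_integral_cmult)
      show "(\<lambda>w. \<Prod>j\<in>A - {i}. ?g j (w j)) \<in> borel_measurable (PiM (A - {i}) N)"
        by (intro borel_measurable_prod_ennreal measurable_PiM_component_rev g_meas)
    qed
    also have "(\<integral>\<^sup>+ w. (\<Prod>j\<in>A - {i}. ?g j (w j)) \<partial>(PiM (A - {i}) N)) = (\<Prod>j\<in>A - {i}. \<integral>\<^sup>+z'. ?g j z' \<partial>N j)"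
      by (rule product_nn_integral_prod) (use A g_meas in auto)
    also have "\<dots> = (\<Prod>j\<in>J. \<integral>\<^sup>+z'. ?g j z' \<partial>N j)"
      by (rule prod.mono_neutral_right) (use A in \<open>auto simp: prob_space.emeasure_space_1[OF N]\<close>)
    also have "\<dots> = (\<Prod>j\<in>J. \<integral>\<^sup>+z'. ennreal (exp (l * T z z')) \<partial>Z)"
      using NJ by (intro prod.cong) auto
    also have "\<dots> \<le> (\<Prod>j\<in>J. \<rho>)"
      using z by (simp add: power_mono)
    finally show "(\<integral>\<^sup>+ w. ?f (w(i := z)) \<partial>(PiM (A - {i}) N)) \<le> ennreal (exp (l * M)) * \<rho> ^ card J"
      by (simp add: mult_left_mono)
  qed
  also have "\<dots> = ennreal (exp (l * M)) * \<rho> ^ card J"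
    by (simp add: prob_space.emeasure_space_1[OF N])
  finally show ?thesis .
qed

text \<open>Probability integral transform without strict monotonicity: if \<open>c\<close> is the
  leftmost point where the distribution function equals \<open>a\<close>, the event is the half-line
  below \<open>c\<close>, and \<open>c\<close> is not an atom.\<close>

lemma (in real_distribution) prob_cdf_less:
  assumes cont: "\<And>x. measure M {x} = 0" and a: "0 < a" "a < 1"
  shows "measure M {x. cdf M x < a} = a"
proof -
  have C: "isCont (cdf M) x" for x using cont isCont_cdf by blast
  have "eventually (\<lambda>x. cdf M x < a) at_bot" using order_tendstoD(2)[OF cdf_lim_at_bot a(1)] .
  then obtain l where l: "cdf M l < a" by (auto simp: eventually_at_bot_linorder)
  have "eventually (\<lambda>x. a < cdf M x) at_top" using order_tendstoD(1)[OF cdf_lim_at_top_prob a(2)] .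
  then obtain u where u: "a < cdf M u" by (auto simp: eventually_at_top_linorder)
  have "l \<le> u" using cdf_nondecreasing[of u l] l u by linarith
  define c where "c = Inf ({l..u} \<inter> cdf M -` {a})"
  have ne: "{l..u} \<inter> cdf M -` {a} \<noteq> {}"
    using IVT[of "cdf M" l a u] l u \<open>l \<le> u\<close> C by auto
  have "closed ({l..u} \<inter> cdf M -` {a})"
    by (rule continuous_closed_vimage[THEN closed_Int[OF closed_atLeastAtMost]]) (use C in auto)
  then have "c \<in> {l..u} \<inter> cdf M -` {a}"
    unfolding c_def using ne by (intro closed_contains_Inf) auto
  then have c: "l \<le> c" "c \<le> u" "cdf M c = a" by auto
  have "cdf M x < a \<longleftrightarrow> x < c" for x
  proof
    assume "cdf M x < a" then show "x < c" using cdf_nondecreasing[of c x] c by (meson leI not_le)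
  next
    assume x: "x < c"
    show "cdf M x < a"
    proof (rule ccontr)
      assume "\<not> cdf M x < a"
      then have eq: "cdf M x = a" using cdf_nondecreasing[of x c] c x by simp
      then have "l \<le> x" using l cdf_nondecreasing[of x l] by (meson leI less_le_not_le not_le order.strict_trans2)
      then have "c \<le> x" unfolding c_def using eq x c by (intro cInf_lower) auto
      with x show False by simp
    qed
  qed
  then have "{x. cdf M x < a} = {..<c}" by auto
  moreover have "measure M {..c} = measure M {..<c} + measure M {c}"
    by (subst finite_measure_Union[symmetric]) (auto intro!: arg_cong[where f = "measure M"])
  ultimately show ?thesis using c(3) cont by (simp add: cdf_def)
qed

text \<open>Used to show that the kernel weight of points beyond a fixed distance is negligible
  against the lower bound of order \<open>h powr \<beta>\<close> for the mean kernel weight.\<close>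

lemma eventually_exp_le_powr:
  fixes \<delta> C \<beta> :: real
  assumes "0 < \<delta>" "0 < C"
  shows "eventually (\<lambda>t. exp (- \<delta> / t) \<le> C * t powr \<beta>) (at_right 0)"
  using assms by real_asymp

lemma union_bound_tendsto_0:
  fixes h :: "nat \<Rightarrow> real"
  assumes c: "0 < c" and C: "0 \<le> C"
    and rate: "filterlim (\<lambda>n. real n * h n powr \<beta> / ln (real n)) at_top sequentially"
  shows "(\<lambda>n. real (n + 1) * (C * exp (- c * h n powr \<beta>) ^ (n - 1))) \<longlonglongrightarrow> 0"
proof (rule tendsto_sandwich)
  show "eventually (\<lambda>n. 0 \<le> real (n + 1) * (C * exp (- c * h n powr \<beta>) ^ (n - 1))) sequentially"
    using C by simp
  \<comment> \<open>One factor 2 of the 4 yields the decay \<open>1 / n\<^sup>2\<close>, which beats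
    the \<open>n + 1\<close> rows; the other comes from \<open>n \<le> 2 * (n - 1)\<close>, as the
    exponent is \<open>n - 1\<close>.\<close>
  have "eventually (\<lambda>n. 4 / c \<le> real n * h n powr \<beta> / ln (real n)) sequentially"
    using rate unfolding filterlim_at_top by blast
  then show "eventually (\<lambda>n. real (n + 1) * (C * exp (- c * h n powr \<beta>) ^ (n - 1))
      \<le> real (n + 1) * (C * (1 / (real n)\<^sup>2))) sequentially"
    using eventually_ge_at_top[of 2]
  proof eventually_elim
    case (elim n)
    have ln: "0 < ln (real n)" using elim by simp
    have "4 * ln (real n) \<le> c * (real n * h n powr \<beta>)" using elim(1) ln c by (simp add: field_simps)
    also have "\<dots> \<le> c * ((2 * real (n - 1)) * h n powr \<beta>)"
      using elim(2) c by (intro mult_left_mono mult_right_mono) (auto simp: of_nat_diff)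
    finally have "real (n - 1) * (- c * h n powr \<beta>) \<le> - (2 * ln (real n))" by (simp add: algebra_simps)
    then have "exp (- c * h n powr \<beta>) ^ (n - 1) \<le> exp (- (2 * ln (real n)))"
      by (simp only: exp_of_nat_mult[symmetric] exp_le_cancel_iff)
    also have "\<dots> = 1 / (real n)\<^sup>2"
      using elim(2) by (simp add: exp_minus exp_of_nat_mult[of 2, simplified] divide_inverse)
    finally show ?case using C by (intro mult_left_mono) auto
  qed
  show "(\<lambda>n. real (n + 1) * (C * (1 / (real n)\<^sup>2))) \<longlonglongrightarrow> 0" by real_asymp
qed simp

lemma exp_power_pred_tendsto_0:
  fixes c C :: real assumes "0 < c" shows "(\<lambda>n. C * exp (- c) ^ (n - 1)) \<longlonglongrightarrow> 0"
proof -
  have "(\<lambda>n. exp (- c) ^ (n - 1)) \<longlonglongrightarrow> 0"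
    by (rule filterlim_compose[OF LIMSEQ_realpow_zero filterlim_minus_const_nat_at_top]) (use assms in auto)
  from tendsto_mult_left[OF this, of C] show ?thesis by simp
qed

subsection \<open>The localized model\<close>

text \<open>The part of the setting that involves neither sample size nor bandwidth; bandwidth and
  small-ball mass enter the lemmas as explicit assumptions.\<close>

locale conformal_model =
  fixes PX :: "(real^'p) measure" and MY :: "'y measure" and K :: "real^'p \<Rightarrow> 'y measure"
    and V :: "(real^'p) \<times> 'y \<Rightarrow> real" and d :: "real^'p \<Rightarrow> real^'p \<Rightarrow> real" and L :: real
  assumes PX_prob: "prob_space PX" and PX_sets: "sets PX = sets borel"
    and PX_cube: "measure PX unit_cube = 1"
    and K_kernel: "K \<in> measurable borel (prob_algebra MY)"
    and V_meas: "V \<in> borel_measurable (borel \<Otimes>\<^sub>M MY)"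
    and V_cont: "\<forall>x\<in>unit_cube. \<forall>v. measure (K x) {y \<in> space MY. V (x, y) = v} = 0"
    and d_meas: "(\<lambda>(a, b). d a b) \<in> borel_measurable (borel \<Otimes>\<^sub>M borel)"
    and d_nonneg: "\<forall>a b. d a b \<ge> 0" and d_refl: "\<forall>a. d a a = 0"
    and L_pos: "L > 0"
    and lip: "\<forall>x\<in>unit_cube. \<forall>x'\<in>unit_cube. \<forall>v.
                 \<bar>cond_cdf MY K V x v - cond_cdf MY K V x' v\<bar> \<le> L * d x x'"
begin

abbreviation "Z \<equiv> borel \<Otimes>\<^sub>M MY"
abbreviation "J \<equiv> joint_law PX MY K"
abbreviation "D x \<equiv> distr (K x) (borel \<Otimes>\<^sub>M MY) (\<lambda>y. (x, y))"
abbreviation "F \<equiv> cond_cdf MY K V"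

text \<open>The probability integral transform of the score given the covariate.\<close>

definition pit :: "(real^'p) \<times> 'y \<Rightarrow> real" where
  "pit z = F (fst z) (V z)"

declare V_meas[measurable] K_kernel[measurable] PX_sets[measurable_cong]

lemma K_prob: "prob_space (K x)" and K_sets[measurable_cong]: "sets (K x) = sets MY"
  using measurable_space[OF K_kernel, of x] by (auto simp: space_prob_algebra)

lemma K_space: "space (K x) = space MY" using sets_eq_imp_space_eq[OF K_sets] .

lemma D_kernel: "(\<lambda>x. D x) \<in> measurable borel (prob_algebra Z)"
  by (rule measurable_distr_prob_space2[OF K_kernel]) simp

lemma D_kernel_PX: "(\<lambda>x. D x) \<in> measurable PX (prob_algebra Z)"
  using D_kernel by (simp cong: measurable_cong_sets add: PX_sets)

lemma PX_algebra: "PX \<in> space (prob_algebra PX)"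
  using PX_prob by (simp add: space_prob_algebra)

lemma J_prob: "prob_space J"
  unfolding joint_law_def by (rule prob_space_bind'[OF PX_algebra D_kernel_PX])

lemma J_sets[measurable_cong]: "sets J = sets Z"
  unfolding joint_law_def by (rule sets_bind'[OF PX_algebra D_kernel_PX])

lemma D_prob: "prob_space (D x)"
  by (intro prob_space.prob_space_distr K_prob) measurable

lemma unit_cube_borel[measurable]: "unit_cube \<in> sets (borel :: (real^'p) measure)"
proof -
  have "closed (unit_cube :: (real^'p) set)"
    unfolding unit_cube_def by (intro closed_Collect_all closed_Collect_conj closed_Collect_le continuous_intros)
  then show ?thesis by simp
qed

lemma AE_PX_cube: "AE x in PX. x \<in> unit_cube"
  using prob_space.AE_prob_1[OF PX_prob PX_cube] .

text \<open>Disintegration: integrate over the response given \<open>x\<close>, then over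
  \<open>x\<close>. The inner integral has to be known only on the cube, which has full measure
  under \<open>PX\<close>.\<close>

lemma integral_joint_law:
  fixes f :: "(real^'p) \<times> 'y \<Rightarrow> real"
  assumes [measurable]: "f \<in> borel_measurable Z" "g \<in> borel_measurable borel"
    and f: "\<And>z. 0 \<le> f z" "\<And>z. f z \<le> 1"
    and g: "\<And>x. x \<in> unit_cube \<Longrightarrow> (\<integral>y. f (x, y) \<partial>K x) = g x" "\<And>x. 0 \<le> g x"
  shows "(\<integral>z. f z \<partial>J) = (\<integral>x. g x \<partial>PX)"
proof -
  have int_f: "integrable (K x) (\<lambda>y. f (x, y))" for x
    by (rule finite_measure.integrable_const_bound[OF prob_space.finite_measure[OF K_prob], of _ 1]) (use f in auto)
  have "(\<integral>z. f z \<partial>J) = enn2real (\<integral>\<^sup>+z. ennreal (f z) \<partial>J)"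
    by (rule integral_eq_nn_integral) (use f in auto)
  also have "(\<integral>\<^sup>+z. ennreal (f z) \<partial>J) = (\<integral>\<^sup>+x. \<integral>\<^sup>+z. ennreal (f z) \<partial>D x \<partial>PX)"
    unfolding joint_law_def
    by (rule nn_integral_bind[OF _ measurable_prob_algebraD[OF D_kernel_PX]]) simp
  also have "\<dots> = (\<integral>\<^sup>+x. \<integral>\<^sup>+y. ennreal (f (x, y)) \<partial>K x \<partial>PX)"
    by (intro nn_integral_cong nn_integral_distr) measurable
  also have "\<dots> = (\<integral>\<^sup>+x. ennreal (g x) \<partial>PX)"
    by (rule nn_integral_cong_AE, use AE_PX_cube in eventually_elim)
      (use f in \<open>simp add: nn_integral_eq_integral[OF int_f] g\<close>)
  also have "enn2real \<dots> = (\<integral>x. g x \<partial>PX)"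
    using g(2) by (intro integral_eq_nn_integral[symmetric]) auto
  finally show ?thesis .
qed

lemma AE_J_cube: "AE z in J. fst z \<in> unit_cube"
proof -
  have "AE z in D x. fst z \<in> unit_cube" if "x \<in> unit_cube" for x
    by (subst AE_distr_iff) (use that in auto)
  then have "AE x in PX. AE z in D x. fst z \<in> unit_cube" using AE_PX_cube by auto
  then show ?thesis unfolding joint_law_def
    by (subst AE_bind[OF measurable_prob_algebraD[OF D_kernel_PX]]) auto
qed

lemma F_bounds: "0 \<le> F x v" "F x v \<le> 1"
  unfolding cond_cdf_def using prob_space.prob_le_1[OF K_prob] by auto

text \<open>Joint measurability is required because \<open>pit\<close> inserts a random score and a
  random covariate at once. It follows from measurability of the kernel applied to sections of a
  measurable set.\<close>

lemma F_meas: "(\<lambda>(x, v). F x v) \<in> borel_measurable (borel \<Otimes>\<^sub>M borel)"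
proof -
  have K': "(\<lambda>p. K (fst p)) \<in> measurable (borel \<Otimes>\<^sub>M (borel :: real measure)) (subprob_algebra MY)"
    by (rule measurable_compose[OF measurable_fst measurable_prob_algebraD[OF K_kernel]])
  have "(\<lambda>p. measure (K (fst p)) {y \<in> space MY. V (fst p, y) \<le> snd p}) \<in> borel_measurable (borel \<Otimes>\<^sub>M (borel :: real measure))"
  proof (rule measure_measurable_subprob_algebra2[OF _ K'])
    have "(SIGMA p:space (borel \<Otimes>\<^sub>M borel). {y \<in> space MY. V (fst p, y) \<le> snd p})
        = {q \<in> space ((borel \<Otimes>\<^sub>M (borel :: real measure)) \<Otimes>\<^sub>M MY). V (fst (fst q), snd q) \<le> snd (fst q)}"
      by (auto simp: space_pair_measure)
    also have "\<dots> \<in> sets ((borel \<Otimes>\<^sub>M (borel :: real measure)) \<Otimes>\<^sub>M MY)" by measurable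
    finally show "(SIGMA p:space (borel \<Otimes>\<^sub>M borel). {y \<in> space MY. V (fst p, y) \<le> snd p})
        \<in> sets ((borel \<Otimes>\<^sub>M (borel :: real measure)) \<Otimes>\<^sub>M MY)" .
  qed
  then show ?thesis by (simp add: cond_cdf_def case_prod_beta')
qed

lemma pit_meas[measurable]: "pit \<in> borel_measurable Z"
  using measurable_compose[OF measurable_Pair[OF measurable_fst V_meas] F_meas]
  by (simp add: pit_def[abs_def])

text \<open>The conditional law of the score has no atoms; this links the strict comparisons in the
  ranks to the conditional distribution function.\<close>

lemma prob_V_less: "x \<in> unit_cube \<Longrightarrow> measure (K x) {y \<in> space MY. V (x, y) < v} = F x v"
proof -
  assume x: "x \<in> unit_cube"
  interpret prob_space "K x" by (rule K_prob)
  have "F x v = measure (K x) ({y \<in> space MY. V (x, y) < v} \<union> {y \<in> space MY. V (x, y) = v})"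
    unfolding cond_cdf_def by (rule arg_cong[where f = "measure (K x)"]) auto
  also have "\<dots> = measure (K x) {y \<in> space MY. V (x, y) < v} + measure (K x) {y \<in> space MY. V (x, y) = v}"
    by (rule finite_measure_Union) (auto simp: K_sets)
  finally show ?thesis using V_cont x by simp
qed

text \<open>The law of the score given \<open>x\<close> has \<open>F x\<close> as its distribution
  function, so \<open>prob_cdf_less\<close> applies to it.\<close>

lemma prob_pit_less_K:
  assumes x: "x \<in> unit_cube" and a: "0 < a" "a < 1"
  shows "measure (K x) {y \<in> space MY. pit (x, y) < a} = a"
proof -
  define R where "R = distr (K x) borel (\<lambda>y. V (x, y))"
  interpret KX: prob_space "K x" by (rule K_prob)
  have Vx[measurable]: "(\<lambda>y. V (x, y)) \<in> borel_measurable (K x)" by measurable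
  interpret real_distribution R
    unfolding R_def by (rule KX.real_distribution_distr) measurable
  have meas: "measure R A = measure (K x) {y \<in> space MY. V (x, y) \<in> A}" if "A \<in> sets borel" for A
    unfolding R_def using that
    by (subst measure_distr) (auto intro!: arg_cong[where f = "measure (K x)"] simp: K_space)
  have cdf: "cdf R v = F x v" for v by (simp add: cdf_def meas cond_cdf_def)
  have "{v. cdf R v < a} \<in> sets borel"
  proof -
    have [measurable]: "cdf R \<in> borel_measurable borel"
      by (intro borel_measurable_mono) (auto simp: mono_def cdf_nondecreasing)
    show ?thesis by measurable
  qed
  moreover have "measure R {v. cdf R v < a} = a"
    by (rule prob_cdf_less[OF _ a]) (use V_cont x in \<open>auto simp: meas\<close>)
  ultimately show ?thesis by (simp add: meas cdf pit_def)
qed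

lemma prob_pit_less_D:
  assumes "x \<in> unit_cube" "0 < a" "a < 1"
  shows "measure (D x) {z \<in> space Z. pit z < a} = a"
proof -
  have "measure (D x) {z \<in> space Z. pit z < a} = measure (K x) {y \<in> space MY. pit (x, y) < a}"
    by (subst measure_distr) (auto intro!: arg_cong[where f = "measure (K x)"] simp: K_space space_pair_measure)
  then show ?thesis using prob_pit_less_K[OF assms] by simp
qed

lemma expectation_pit_less:
  assumes "0 < a" "a < 1"
  shows "(\<integral>z. (if pit z < a then 1 else 0) \<partial>J) = a"
proof -
  have inner: "(\<integral>y. (if pit (x, y) < a then 1 else 0) \<partial>K x) = a" if "x \<in> unit_cube" for x
  proof -
    have "(\<integral>y. (if pit (x, y) < a then 1 else 0) \<partial>K x) = (\<integral>y. indicator {y \<in> space MY. pit (x, y) < a} y \<partial>K x)"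
      by (intro Bochner_Integration.integral_cong) (auto simp: K_space)
    also have "\<dots> = a"
      using prob_pit_less_K[OF that assms] by (simp add: K_space Int_absorb2 Int_def conj_commute cong: conj_cong)
    finally show ?thesis .
  qed
  have "(\<integral>z. (if pit z < a then 1 else 0) \<partial>J) = (\<integral>x. a \<partial>PX)"
    by (rule integral_joint_law) (use assms inner in auto)
  also have "\<dots> = a" using prob_space.prob_space[OF PX_prob] by simp
  finally show ?thesis .
qed

section \<open>Kernel averages: lower bound on the mean weight and localization bias\<close>

lemma locH_bounds: "0 < hb \<Longrightarrow> 0 \<le> locH d hb x x'" "0 < hb \<Longrightarrow> locH d hb x x' \<le> 1"
  using d_nonneg by (auto simp: locH_def intro!: divide_nonneg_pos)

lemma locH_meas: "(\<lambda>(x, x'). locH d hb x x') \<in> borel_measurable (borel \<Otimes>\<^sub>M borel)"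
  unfolding locH_def case_prod_beta'
  using d_meas[unfolded case_prod_beta']
  by (intro borel_measurable_exp[THEN measurable_compose[rotated]] borel_measurable_divide
        borel_measurable_uminus borel_measurable_const)

lemma locH_meas2: "locH d hb x \<in> borel_measurable borel"
  using measurable_compose[OF measurable_Pair1'[of x borel borel] locH_meas] by simp

lemma expectation_locH: "0 < hb \<Longrightarrow> (\<integral>z. locH d hb x (fst z) \<partial>J) = (\<integral>x'. locH d hb x x' \<partial>PX)"
  by (rule integral_joint_law)
    (auto intro!: locH_bounds locH_meas2 measurable_compose[OF measurable_fst] simp: prob_space.prob_space[OF K_prob])

text \<open>The kernel is at least \<open>exp (-1)\<close> within distance
  \<open>hb\<close>.\<close>

lemma expectation_locH_ge:
  assumes hb: "0 < hb" and mass: "m \<le> measure PX {x' \<in> space PX. d x x' \<le> hb}"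
  shows "exp (-1) * m \<le> (\<integral>x'. locH d hb x x' \<partial>PX)"
proof -
  interpret prob_space PX by (rule PX_prob)
  note locH_meas2[measurable]
  have dx[measurable]: "d x \<in> borel_measurable borel"
    using measurable_compose[OF measurable_Pair1'[of x borel borel] d_meas] by simp
  let ?A = "{x' \<in> space PX. d x x' \<le> hb}"
  have A: "?A \<in> sets PX" by measurable
  have "exp (-1) * m \<le> exp (-1) * measure PX ?A" using mass by simp
  also have "\<dots> = (\<integral>x'. exp (-1) * indicator ?A x' \<partial>PX)" using A by simp
  also have "\<dots> \<le> (\<integral>x'. locH d hb x x' \<partial>PX)"
  proof (rule integral_mono)
    show "integrable PX (\<lambda>x'. locH d hb x x')"
      by (rule integrable_const_bound[where B = 1]) (use locH_bounds[OF hb] in auto)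
    show "integrable PX (\<lambda>x'. exp (-1) * indicator ?A x' :: real)"
      by (rule integrable_const_bound[where B = "exp (-1)"]) (auto simp: indicator_def)
    fix x'
    show "exp (-1) * indicator ?A x' \<le> locH d hb x x'"
      using hb by (auto simp: indicator_def locH_def field_simps)
  qed
  finally show ?thesis .
qed

text \<open>Localization bias, split at distance \<open>e / (2 * L)\<close>. Nearer points change
  the conditional distribution function by at most \<open>e / 2\<close>, by the Lipschitz condition.
  Farther points have kernel weight so small that \<open>small\<close> bounds it by
  \<open>e / 4\<close> of the mean weight. Together this gives \<open>3 / 4 * e\<close>.\<close>

lemma expectation_locH_below:
  assumes hb: "0 < hb" and x: "x \<in> unit_cube" and e: "0 < e"
    and small: "exp (- (e / (2 * L)) / hb) \<le> e / 4 * (\<integral>x'. locH d hb x x' \<partial>PX)"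
  shows "\<bar>(\<integral>z. locH d hb x (fst z) * (if V z < v then 1 else 0) \<partial>J) - F x v * (\<integral>x'. locH d hb x x' \<partial>PX)\<bar>
      \<le> 3 / 4 * e * (\<integral>x'. locH d hb x x' \<partial>PX)"
proof -
  interpret prob_space PX by (rule PX_prob)
  note locH_meas2[measurable]
  have Fv[measurable]: "(\<lambda>x. F x v) \<in> borel_measurable borel"
    using measurable_compose[OF measurable_Pair2'[of v borel borel] F_meas] by simp
  let ?H = "locH d hb x"
  define \<mu> where "\<mu> = (\<integral>x'. ?H x' \<partial>PX)"
  have H: "0 \<le> ?H x'" "?H x' \<le> 1" for x' using locH_bounds[OF hb] by auto
  have intH: "integrable PX ?H" by (rule integrable_const_bound[where B = 1]) (use H in auto)
  have intHF: "integrable PX (\<lambda>x'. ?H x' * F x' v)"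
    by (rule integrable_const_bound[where B = 1]) (use H F_bounds in \<open>auto intro!: mult_le_one simp: abs_mult\<close>)
  have E: "(\<integral>z. ?H (fst z) * (if V z < v then 1 else 0) \<partial>J) = (\<integral>x'. ?H x' * F x' v \<partial>PX)"
  proof (rule integral_joint_law)
    fix x' :: "real^'p" assume x': "x' \<in> unit_cube"
    have "(\<integral>y. ?H (fst (x', y)) * (if V (x', y) < v then 1 else 0) \<partial>K x')
        = (\<integral>y. ?H x' * indicator {y \<in> space MY. V (x', y) < v} y \<partial>K x')"
      by (intro Bochner_Integration.integral_cong) (auto simp: K_space)
    also have "\<dots> = ?H x' * F x' v"
      using prob_V_less[OF x', of v] by (simp add: K_space Int_def conj_commute cong: conj_cong)
    finally show "(\<integral>y. ?H (fst (x', y)) * (if V (x', y) < v then 1 else 0) \<partial>K x') = ?H x' * F x' v" .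
  qed (use H F_bounds in auto)
  have "(\<integral>z. ?H (fst z) * (if V z < v then 1 else 0) \<partial>J) - F x v * \<mu> = (\<integral>x'. ?H x' * F x' v - F x v * ?H x' \<partial>PX)"
    unfolding \<mu>_def E using intH intHF by simp
  then have "\<bar>(\<integral>z. ?H (fst z) * (if V z < v then 1 else 0) \<partial>J) - F x v * \<mu>\<bar>
      = \<bar>\<integral>x'. ?H x' * F x' v - F x v * ?H x' \<partial>PX\<bar>" by (simp only:)
  also have "\<dots> \<le> (\<integral>x'. \<bar>?H x' * F x' v - F x v * ?H x'\<bar> \<partial>PX)" by (rule integral_abs_bound)
  \<comment> \<open>Adding the near and the far bound gives one majorant for both cases, so the
    integral need not be split.\<close>
  also have "\<dots> \<le> (\<integral>x'. e / 2 * ?H x' + exp (- (e / (2 * L)) / hb) \<partial>PX)"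
  proof (rule integral_mono_AE)
    show "AE x' in PX. \<bar>?H x' * F x' v - F x v * ?H x'\<bar> \<le> e / 2 * ?H x' + exp (- (e / (2 * L)) / hb)"
      using AE_PX_cube
    proof eventually_elim
      fix x' :: "real^'p" assume x': "x' \<in> unit_cube"
      have eq: "\<bar>?H x' * F x' v - F x v * ?H x'\<bar> = \<bar>F x v - F x' v\<bar> * ?H x'"
      proof -
        have "?H x' * F x' v - F x v * ?H x' = - (F x v - F x' v) * ?H x'" by (simp add: algebra_simps)
        then show ?thesis using H(1)[of x'] by (simp only: abs_mult abs_minus_cancel abs_of_nonneg)
      qed
      show "\<bar>?H x' * F x' v - F x v * ?H x'\<bar> \<le> e / 2 * ?H x' + exp (- (e / (2 * L)) / hb)"
      proof (cases "d x x' \<le> e / (2 * L)")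
        case True
        have "\<bar>F x v - F x' v\<bar> \<le> L * d x x'" using lip x x' by blast
        also have "\<dots> \<le> L * (e / (2 * L))" using True L_pos by (intro mult_left_mono) auto
        finally have "\<bar>F x v - F x' v\<bar> \<le> e / 2" using L_pos by simp
        then have "\<bar>F x v - F x' v\<bar> * ?H x' \<le> e / 2 * ?H x'" using H by (intro mult_right_mono) auto
        then show ?thesis unfolding eq by (simp add: add_increasing2)
      next
        case False
        have "\<bar>F x v - F x' v\<bar> \<le> 1" using F_bounds[of x v] F_bounds[of x' v] by linarith
        then have "\<bar>F x v - F x' v\<bar> * ?H x' \<le> 1 * ?H x'" using H by (intro mult_right_mono) auto
        moreover have "?H x' \<le> exp (- (e / (2 * L)) / hb)"
          using False hb unfolding locH_def exp_le_cancel_iff by (intro divide_right_mono) auto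
        moreover have "0 \<le> e / 2 * ?H x'" using e H by simp
        ultimately show ?thesis unfolding eq by linarith
      qed
    qed
  qed (use intH intHF in auto)
  also have "\<dots> = e / 2 * \<mu> + exp (- (e / (2 * L)) / hb)"
    unfolding \<mu>_def using intH by (simp add: prob_space)
  also have "\<dots> \<le> 3 / 4 * e * \<mu>" using small unfolding \<mu>_def by simp
  finally show ?thesis unfolding \<mu>_def .
qed

text \<open>The weighted rank of an observation \<open>z\<close> exceeds \<open>pit z + e\<close> iff the sum of the i.i.d.
  variables \<open>T_up\<close> is positive, up to the terms of \<open>z\<close> itself and of the test point, which
  contribute at most 2.\<close>

definition T_up :: "real \<Rightarrow> real \<Rightarrow> (real^'p) \<times> 'y \<Rightarrow> (real^'p) \<times> 'y \<Rightarrow> real" where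
  "T_up hb e z z' = locH d hb (fst z) (fst z') * ((if V z' < V z then 1 else 0) - pit z - e)"

definition T_lo :: "real \<Rightarrow> real \<Rightarrow> (real^'p) \<times> 'y \<Rightarrow> (real^'p) \<times> 'y \<Rightarrow> real" where
  "T_lo hb e z z' = locH d hb (fst z) (fst z') * (pit z - e - (if V z' < V z then 1 else 0))"

lemma locH_fst_meas[measurable]: "(\<lambda>p. locH d hb (fst (fst p)) (fst (snd p))) \<in> borel_measurable (Z \<Otimes>\<^sub>M Z)"
  using measurable_compose[OF measurable_Pair[OF measurable_compose[OF measurable_fst measurable_fst]
        measurable_compose[OF measurable_snd measurable_fst]] locH_meas] by simp

lemma T_up_meas: "(\<lambda>(z, z'). T_up hb e z z') \<in> borel_measurable (Z \<Otimes>\<^sub>M Z)"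
  unfolding T_up_def case_prod_beta' by measurable

lemma T_lo_meas: "(\<lambda>(z, z'). T_lo hb e z z') \<in> borel_measurable (Z \<Otimes>\<^sub>M Z)"
  unfolding T_lo_def case_prod_beta' by measurable

text \<open>The margin \<open>e\<close> minus the bias \<open>3 / 4 * e\<close> leaves a drift of
  \<open>e / 4\<close> times the mean weight. Taking \<open>\<kappa> = e / 4\<close> in
  \<open>nn_integral_exp_drift_le\<close> produces the constants \<open>e / 32\<close> and
  \<open>e\<^sup>2 / 256\<close>; the mean weight is then replaced by its lower bound
  \<open>exp (-1) * m\<close>, which does not depend on \<open>z\<close>.\<close>

lemma nn_integral_exp_T_le:
  assumes hb: "0 < hb" and e: "0 < e" "e \<le> 1" and z: "fst z \<in> unit_cube"
    and mass: "m \<le> measure PX {x' \<in> space PX. d (fst z) x' \<le> hb}"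
    and small: "exp (- (e / (2 * L)) / hb) \<le> e / 4 * (exp (-1) * m)"
  shows "(\<integral>\<^sup>+z'. ennreal (exp (e / 32 * T_up hb e z z')) \<partial>J) \<le> ennreal (exp (- (e\<^sup>2 / 256) * (exp (-1) * m)))"
    and "(\<integral>\<^sup>+z'. ennreal (exp (e / 32 * T_lo hb e z z')) \<partial>J) \<le> ennreal (exp (- (e\<^sup>2 / 256) * (exp (-1) * m)))"
proof -
  interpret prob_space J by (rule J_prob)
  let ?g = "\<lambda>z'. locH d hb (fst z) (fst z')"
  let ?I = "\<lambda>z'. if V z' < V z then 1 else 0 :: real"
  define \<mu> where "\<mu> = (\<integral>x'. locH d hb (fst z) x' \<partial>PX)"
  have \<mu>: "exp (-1) * m \<le> \<mu>" unfolding \<mu>_def by (rule expectation_locH_ge[OF hb mass])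
  have E_g: "expectation ?g = \<mu>" unfolding \<mu>_def by (rule expectation_locH[OF hb])
  have "exp (- (e / (2 * L)) / hb) \<le> e / 4 * \<mu>"
    using small \<mu> e by (meson mult_left_mono order_trans less_imp_le divide_nonneg_pos zero_less_numeral)
  then have E_I: "\<bar>expectation (\<lambda>z'. ?g z' * ?I z') - pit z * \<mu>\<bar> \<le> 3 / 4 * e * \<mu>"
    unfolding \<mu>_def pit_def by (rule expectation_locH_below[OF hb z e(1)])
  then have E_bnd: "expectation (\<lambda>z'. ?g z' * ?I z') \<le> pit z * \<mu> + 3 / 4 * e * \<mu>"
    "pit z * \<mu> - 3 / 4 * e * \<mu> \<le> expectation (\<lambda>z'. ?g z' * ?I z')" by linarith+
  have g_meas[measurable]: "?g \<in> borel_measurable Z"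
    by (rule measurable_compose[OF measurable_fst locH_meas2])
  have g: "0 \<le> ?g z'" "?g z' \<le> 1" for z' using locH_bounds[OF hb] by auto
  have int_g: "integrable J ?g" by (rule integrable_const_bound[where B = 1]) (use g in auto)
  have int_gI: "integrable J (\<lambda>z'. ?g z' * ?I z')" by (rule integrable_const_bound[where B = 1]) (use g in auto)
  have pit: "0 \<le> pit z" "pit z \<le> 1" unfolding pit_def by (rule F_bounds)+
  have up_eq: "T_up hb e z = (\<lambda>z'. ?g z' * ?I z' - (pit z + e) * ?g z')"
    by (rule ext) (simp add: T_up_def algebra_simps)
  have lo_eq: "T_lo hb e z = (\<lambda>z'. (pit z - e) * ?g z' - ?g z' * ?I z')"
    by (rule ext) (simp add: T_lo_def algebra_simps)
  have E_up: "expectation (T_up hb e z) \<le> - (e / 4) * expectation ?g"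
  proof -
    have "expectation (T_up hb e z) = expectation (\<lambda>z'. ?g z' * ?I z') - (pit z + e) * \<mu>"
      unfolding up_eq using int_g int_gI E_g by simp
    then show ?thesis using E_bnd unfolding E_g by (simp add: algebra_simps)
  qed
  have E_lo: "expectation (T_lo hb e z) \<le> - (e / 4) * expectation ?g"
  proof -
    have "expectation (T_lo hb e z) = (pit z - e) * \<mu> - expectation (\<lambda>z'. ?g z' * ?I z')"
      unfolding lo_eq using int_g int_gI E_g by simp
    then show ?thesis using E_bnd unfolding E_g by (simp add: algebra_simps)
  qed
  have bnd: "\<bar>?g z' * s\<bar> \<le> 2 * ?g z'" if "\<bar>s\<bar> \<le> 2" for s z'
    using mult_left_mono[OF that g(1)[of z']] g(1)[of z'] by (simp add: abs_mult mult.commute)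
  have up_bnd: "\<bar>T_up hb e z z'\<bar> \<le> 2 * ?g z'" and lo_bnd: "\<bar>T_lo hb e z z'\<bar> \<le> 2 * ?g z'" for z'
    unfolding T_up_def T_lo_def by (rule bnd; use pit e in auto)+
  have up_meas: "T_up hb e z \<in> borel_measurable J" and lo_meas: "T_lo hb e z \<in> borel_measurable J"
    unfolding up_eq lo_eq by measurable
  have le: "exp (- ((e / 4)\<^sup>2 / 16) * expectation ?g) \<le> exp (- (e\<^sup>2 / 256) * (exp (-1) * m))"
    unfolding E_g using \<mu> e by (simp add: power2_eq_square mult_left_mono)
  have "(\<integral>\<^sup>+z'. ennreal (exp (e / 4 / 8 * T_up hb e z z')) \<partial>J) \<le> ennreal (exp (- ((e / 4)\<^sup>2 / 16) * expectation ?g))"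
    by (rule nn_integral_exp_drift_le)
      (use up_meas up_bnd g e E_up in auto)
  also note ennreal_leI[OF le]
  finally show "(\<integral>\<^sup>+z'. ennreal (exp (e / 32 * T_up hb e z z')) \<partial>J) \<le> ennreal (exp (- (e\<^sup>2 / 256) * (exp (-1) * m)))"
    by simp
  have "(\<integral>\<^sup>+z'. ennreal (exp (e / 4 / 8 * T_lo hb e z z')) \<partial>J) \<le> ennreal (exp (- ((e / 4)\<^sup>2 / 16) * expectation ?g))"
    by (rule nn_integral_exp_drift_le)
      (use lo_meas lo_bnd g e E_lo in auto)
  also note ennreal_leI[OF le]
  finally show "(\<integral>\<^sup>+z'. ennreal (exp (e / 32 * T_lo hb e z z')) \<partial>J) \<le> ennreal (exp (- (e\<^sup>2 / 256) * (exp (-1) * m)))"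
    by simp
qed

text \<open>The case \<open>g = 1\<close>, for plain frequencies without localization.\<close>

lemma nn_integral_exp_bounded_le:
  assumes [measurable]: "t \<in> borel_measurable Z" and t: "\<And>z. \<bar>t z\<bar> \<le> 2"
    and \<kappa>: "0 \<le> \<kappa>" "\<kappa> \<le> 2" and E: "(\<integral>z. t z \<partial>J) \<le> - \<kappa>"
  shows "(\<integral>\<^sup>+z. ennreal (exp (\<kappa> / 8 * t z)) \<partial>J) \<le> ennreal (exp (- (\<kappa>\<^sup>2 / 16)))"
proof -
  interpret prob_space J by (rule J_prob)
  show ?thesis
    using nn_integral_exp_drift_le[of t "\<lambda>_. 1" \<kappa>] t \<kappa> E by (simp add: prob_space)
qed

subsection \<open>Deviation bounds for the sample\<close>

abbreviation "Zlaw n x0 \<equiv> (\<lambda>i. if i = n+1 then D x0 else J)"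

lemma sample_law_eq: "sample_law PX MY K n x0 = PiM {1..n+1} (Zlaw n x0)"
  by (simp add: sample_law_def)

lemma Zlaw_prob: "prob_space (Zlaw n x0 i)" using J_prob D_prob by simp

lemma Zlaw_sets: "sets (Zlaw n x0 i) = sets Z" using J_sets by simp

lemma sample_prob: "prob_space (sample_law PX MY K n x0)"
  unfolding sample_law_eq by (rule prob_space_PiM[OF Zlaw_prob])

lemma sample_component: "i \<in> {1..n+1} \<Longrightarrow> (\<lambda>w. w i) \<in> measurable (sample_law PX MY K n x0) Z"
  unfolding sample_law_eq
  by (subst measurable_cong_sets[OF refl Zlaw_sets[of i n x0, symmetric]]) (rule measurable_component_singleton)

lemma AE_Zlaw_cube:
  assumes "x0 \<in> unit_cube" shows "AE z in Zlaw n x0 i. fst z \<in> unit_cube"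
proof -
  have "AE z in D x0. fst z \<in> unit_cube" by (subst AE_distr_iff) (use assms in auto)
  then show ?thesis using AE_J_cube by simp
qed

text \<open>The summation set avoids the test point, whose law differs, so given coordinate
  \<open>i\<close> all terms are independent with law \<open>J\<close>. The slack 2 costs the factor
  \<open>exp (2 * l)\<close>, at most \<open>exp 1\<close>.\<close>

lemma sample_tail:
  assumes x0: "x0 \<in> unit_cube" and i: "i \<in> {1..n+1}"
    and T: "(\<lambda>(z, z'). T z z') \<in> borel_measurable (Z \<Otimes>\<^sub>M Z)"
    and l: "0 \<le> l" "l \<le> 1 / 2" and r: "0 \<le> r" "r \<le> 1"
    and bound: "\<And>z. fst z \<in> unit_cube \<Longrightarrow> (\<integral>\<^sup>+z'. ennreal (exp (l * T z z')) \<partial>J) \<le> ennreal r"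
  shows "measure (sample_law PX MY K n x0)
      {w \<in> space (sample_law PX MY K n x0). - 2 \<le> (\<Sum>j\<in>{1..n}-{i}. T (w i) (w j))} \<le> exp 1 * r ^ (n - 1)"
proof -
  let ?C = "{1..n}-{i}"
  have "emeasure (PiM {1..n+1} (Zlaw n x0)) {w \<in> space (PiM {1..n+1} (Zlaw n x0)). - 2 \<le> (\<Sum>j\<in>?C. T (w i) (w j))}
      \<le> ennreal (exp (l * 2)) * ennreal r ^ card ?C"
  proof (rule emeasure_PiM_pair_sum_ge[where Z = J])
    show "AE z in Zlaw n x0 i. (\<integral>\<^sup>+z'. ennreal (exp (l * T z z')) \<partial>J) \<le> ennreal r"
      using AE_Zlaw_cube[OF x0, of i n] by eventually_elim (rule bound)
    show "(\<lambda>(z, z'). T z z') \<in> borel_measurable (J \<Otimes>\<^sub>M J)"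
      using T by (simp cong: measurable_cong_sets sets_pair_measure_cong add: J_sets)
  qed (use i l D_prob J_prob J_sets in auto)
  also have "\<dots> \<le> ennreal (exp 1 * r ^ (n - 1))"
  proof -
    \<comment> \<open>Row \<open>n+1\<close> has \<open>n\<close> terms and every other row
      \<open>n - 1\<close>.\<close>
    have "n - 1 \<le> card ?C" by (cases "i \<in> {1..n}") auto
    then have "r ^ card ?C \<le> r ^ (n - 1)" using r by (intro power_decreasing) auto
    then have "exp (l * 2) * r ^ card ?C \<le> exp 1 * r ^ (n - 1)" using l r by (intro mult_mono) auto
    then show ?thesis using r by (simp add: ennreal_power ennreal_mult'' ennreal_leI flip: ennreal_mult'')
  qed
  finally show ?thesis
    unfolding sample_law_eq[symmetric] using r
    by (simp add: finite_measure.emeasure_eq_measure[OF prob_space.finite_measure[OF sample_prob]])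
qed

definition bad_row :: "nat \<Rightarrow> real \<Rightarrow> real \<Rightarrow> nat \<Rightarrow> (nat \<Rightarrow> (real^'p) \<times> 'y) \<Rightarrow> bool" where
  "bad_row n hb e i w \<longleftrightarrow> - 2 \<le> (\<Sum>j\<in>{1..n}-{i}. T_up hb e (w i) (w j))
     \<or> - 2 \<le> (\<Sum>j\<in>{1..n}-{i}. T_lo hb e (w i) (w j))"

abbreviation "ind b \<equiv> (if b then 1 else 0 :: real)"

text \<open>Negating the three clauses gives, in this order, the assumptions \<open>up\<close>,
  \<open>lo\<close> and \<open>gap\<close> of \<open>alpha_tilde_near\<close>; the slack 2 absorbs
  the difference between \<open>n\<close> and \<open>n + 1\<close> and the extra 1 in
  \<open>lo\<close>.\<close>

definition bad_freq :: "nat \<Rightarrow> real \<Rightarrow> real \<Rightarrow> (nat \<Rightarrow> (real^'p) \<times> 'y) \<Rightarrow> bool" where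
  "bad_freq n e \<alpha> w \<longleftrightarrow> - 2 \<le> (\<Sum>j\<in>{1..n}. \<alpha> - ind (pit (w j) < \<alpha> + e / 4))
     \<or> - 2 \<le> (\<Sum>j\<in>{1..n}. ind (pit (w j) < \<alpha> - e / 2) - \<alpha>)
     \<or> - 2 \<le> (\<Sum>j\<in>{1..n}. ind (pit (w j) < \<alpha> + 5 * e / 8) - ind (pit (w j) < \<alpha> + 7 * e / 8))"

lemma T_sum_meas:
  assumes T: "(\<lambda>(z, z'). T z z') \<in> borel_measurable (Z \<Otimes>\<^sub>M Z)" and i: "i \<in> {1..n+1}"
  shows "{w \<in> space (sample_law PX MY K n x0). - 2 \<le> (\<Sum>j\<in>{1..n}-{i}. T (w i) (w j) :: real)}
    \<in> sets (sample_law PX MY K n x0)"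
proof -
  have "(\<lambda>w. T (w i) (w j)) \<in> borel_measurable (sample_law PX MY K n x0)" if "j \<in> {1..n}" for j
  proof -
    have "j \<in> {1..n+1}" using that by auto
    then show ?thesis
      using measurable_compose[OF measurable_Pair[OF sample_component[OF i] sample_component[of j]] T] by simp
  qed
  then show ?thesis by (intro borel_measurable_le borel_measurable_sum borel_measurable_const) auto
qed

lemma prob_bad_row:
  assumes x0: "x0 \<in> unit_cube" and i: "i \<in> {1..n+1}" and hb: "0 < hb" and e: "0 < e" "e \<le> 1"
    and m: "0 \<le> m"
    and mass: "\<And>x. x \<in> unit_cube \<Longrightarrow> m \<le> measure PX {x' \<in> space PX. d x x' \<le> hb}"
    and small: "exp (- (e / (2 * L)) / hb) \<le> e / 4 * (exp (-1) * m)"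
  shows "{w \<in> space (sample_law PX MY K n x0). bad_row n hb e i w} \<in> sets (sample_law PX MY K n x0)"
    and "measure (sample_law PX MY K n x0) {w \<in> space (sample_law PX MY K n x0). bad_row n hb e i w}
      \<le> 2 * exp 1 * exp (- (e\<^sup>2 / 256) * (exp (-1) * m)) ^ (n - 1)"
proof -
  let ?S = "sample_law PX MY K n x0" and ?r = "exp (- (e\<^sup>2 / 256) * (exp (-1) * m))"
  interpret prob_space ?S by (rule sample_prob)
  let ?U = "{w \<in> space ?S. - 2 \<le> (\<Sum>j\<in>{1..n}-{i}. T_up hb e (w i) (w j))}"
  let ?L = "{w \<in> space ?S. - 2 \<le> (\<Sum>j\<in>{1..n}-{i}. T_lo hb e (w i) (w j))}"
  have eq: "{w \<in> space ?S. bad_row n hb e i w} = ?U \<union> ?L" by (auto simp: bad_row_def)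
  have sets: "?U \<in> events" "?L \<in> events" by (rule T_sum_meas[OF T_up_meas i] T_sum_meas[OF T_lo_meas i])+
  show "{w \<in> space ?S. bad_row n hb e i w} \<in> events" unfolding eq using sets by auto
  have r: "?r \<le> 1" using e m by simp
  have "prob ?U \<le> exp 1 * ?r ^ (n - 1)"
    by (rule sample_tail[OF x0 i T_up_meas _ _ _ r nn_integral_exp_T_le(1)[OF hb e _ mass small]]) (use e in auto)
  moreover have "prob ?L \<le> exp 1 * ?r ^ (n - 1)"
    by (rule sample_tail[OF x0 i T_lo_meas _ _ _ r nn_integral_exp_T_le(2)[OF hb e _ mass small]]) (use e in auto)
  ultimately show "prob {w \<in> space ?S. bad_row n hb e i w} \<le> 2 * exp 1 * ?r ^ (n - 1)"
    unfolding eq using measure_Un_le[OF sets] by linarith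
qed

lemma prob_bad_freq:
  assumes x0: "x0 \<in> unit_cube" and e: "0 < e" "0 < \<alpha> - e" "\<alpha> + e < 1"
  shows "{w \<in> space (sample_law PX MY K n x0). bad_freq n e \<alpha> w} \<in> sets (sample_law PX MY K n x0)"
    and "measure (sample_law PX MY K n x0) {w \<in> space (sample_law PX MY K n x0). bad_freq n e \<alpha> w}
      \<le> 3 * exp 1 * exp (- (e\<^sup>2 / 256)) ^ (n - 1)"
proof -
  let ?S = "sample_law PX MY K n x0" and ?r = "exp (- (e\<^sup>2 / 256))"
  interpret prob_space ?S by (rule sample_prob)
  interpret J: prob_space J by (rule J_prob)
  define E where "E t = {w \<in> space ?S. - 2 \<le> (\<Sum>j\<in>{1..n}. t (w j))}" for t :: "(real^'p) \<times> 'y \<Rightarrow> real"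
  \<comment> \<open>A plain frequency is treated as a sum for row \<open>n+1\<close> whose terms
    ignore the first argument, which makes \<open>sample_tail\<close> applicable.\<close>
  have n: "{1..n} - {n+1} = {1..n}" by auto
  have tail: "E t \<in> events \<and> prob (E t) \<le> exp 1 * ?r ^ (n - 1)"
    if t: "t \<in> borel_measurable Z" "\<And>z. \<bar>t z\<bar> \<le> 2" "(\<integral>z. t z \<partial>J) \<le> - (e / 4)" for t
  proof
    have T: "(\<lambda>(z :: (real^'p) \<times> 'y, z'). t z') \<in> borel_measurable (Z \<Otimes>\<^sub>M Z)" using t(1) by measurable
    show "E t \<in> events" unfolding E_def using T_sum_meas[OF T, of "n+1" n] by (simp add: n)
    have "(\<integral>\<^sup>+z'. ennreal (exp (e / 4 / 8 * t z')) \<partial>J) \<le> ennreal (exp (- ((e / 4)\<^sup>2 / 16)))"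
      by (rule nn_integral_exp_bounded_le) (use t e in auto)
    then have "(\<integral>\<^sup>+z'. ennreal (exp (e / 32 * t z')) \<partial>J) \<le> ennreal ?r" by (simp add: power2_eq_square)
    then show "prob (E t) \<le> exp 1 * ?r ^ (n - 1)"
      unfolding E_def using sample_tail[OF x0 _ T, of "n+1" n "e / 32" ?r] e by (simp add: n)
  qed
  have int: "integrable J (\<lambda>z. ind (pit z < a))" for a
    by (rule J.integrable_const_bound[where B = 1]) auto
  let ?t1 = "\<lambda>z. \<alpha> - ind (pit z < \<alpha> + e / 4)" and ?t2 = "\<lambda>z. ind (pit z < \<alpha> - e / 2) - \<alpha>"
    and ?t3 = "\<lambda>z. ind (pit z < \<alpha> + 5 * e / 8) - ind (pit z < \<alpha> + 7 * e / 8)"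
  \<comment> \<open>Uniformity of \<open>pit\<close> gives the three means \<open>-e/4\<close>,
    \<open>-e/2\<close> and \<open>-e/4\<close>; the bounds on \<open>\<alpha>\<close> keep all
    thresholds inside the unit interval.\<close>
  have 1: "E ?t1 \<in> events \<and> prob (E ?t1) \<le> exp 1 * ?r ^ (n - 1)"
    by (rule tail) (use e int expectation_pit_less in \<open>auto simp: J.prob_space\<close>)
  have 2: "E ?t2 \<in> events \<and> prob (E ?t2) \<le> exp 1 * ?r ^ (n - 1)"
    by (rule tail) (use e int expectation_pit_less in \<open>auto simp: J.prob_space\<close>)
  have 3: "E ?t3 \<in> events \<and> prob (E ?t3) \<le> exp 1 * ?r ^ (n - 1)"
    by (rule tail) (use e int expectation_pit_less in \<open>auto simp: J.prob_space\<close>)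
  have eq: "{w \<in> space ?S. bad_freq n e \<alpha> w} = E ?t1 \<union> E ?t2 \<union> E ?t3"
    unfolding bad_freq_def E_def by blast
  show "{w \<in> space ?S. bad_freq n e \<alpha> w} \<in> events" unfolding eq using 1 2 3 by auto
  have "prob (E ?t1 \<union> E ?t2 \<union> E ?t3) \<le> prob (E ?t1 \<union> E ?t2) + prob (E ?t3)"
    by (rule measure_Un_le) (use 1 2 3 in auto)
  also have "prob (E ?t1 \<union> E ?t2) \<le> prob (E ?t1) + prob (E ?t2)"
    by (rule measure_Un_le) (use 1 2 3 in auto)
  finally show "prob {w \<in> space ?S. bad_freq n e \<alpha> w} \<le> 3 * exp 1 * ?r ^ (n - 1)"
    unfolding eq using 1 2 3 by linarith
qed

text \<open>The row accuracy \<open>e / 8\<close> is the one required by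
  \<open>alpha_tilde_near\<close>. Row \<open>n+1\<close> is included because coverage also depends
  on the rank of the test score.\<close>

definition good :: "nat \<Rightarrow> real \<Rightarrow> real \<Rightarrow> real \<Rightarrow> (nat \<Rightarrow> (real^'p) \<times> 'y) \<Rightarrow> bool" where
  "good n hb e \<alpha> w \<longleftrightarrow> (\<forall>i\<in>{1..n+1}. \<not> bad_row n hb (e / 8) i w) \<and> \<not> bad_freq n e \<alpha> w"

lemma prob_good:
  assumes x0: "x0 \<in> unit_cube" and hb: "0 < hb" and e: "0 < e" "0 < \<alpha> - e" "\<alpha> + e < 1"
    and m: "0 \<le> m"
    and mass: "\<And>x. x \<in> unit_cube \<Longrightarrow> m \<le> measure PX {x' \<in> space PX. d x x' \<le> hb}"
    and small: "exp (- (e / 8 / (2 * L)) / hb) \<le> e / 8 / 4 * (exp (-1) * m)"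
  shows "{w \<in> space (sample_law PX MY K n x0). good n hb e \<alpha> w} \<in> sets (sample_law PX MY K n x0)"
    and "1 - (real (n + 1) * (2 * exp 1 * exp (- ((e / 8)\<^sup>2 / 256) * (exp (-1) * m)) ^ (n - 1))
        + 3 * exp 1 * exp (- (e\<^sup>2 / 256)) ^ (n - 1))
      \<le> measure (sample_law PX MY K n x0) {w \<in> space (sample_law PX MY K n x0). good n hb e \<alpha> w}"
proof -
  let ?S = "sample_law PX MY K n x0"
  interpret prob_space ?S by (rule sample_prob)
  let ?R = "\<lambda>i. {w \<in> space ?S. bad_row n hb (e / 8) i w}" and ?F = "{w \<in> space ?S. bad_freq n e \<alpha> w}"
  let ?r = "2 * exp 1 * exp (- ((e / 8)\<^sup>2 / 256) * (exp (-1) * m)) ^ (n - 1)"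
  have e8: "0 < e / 8" "e / 8 \<le> 1" using e by auto
  have R: "?R i \<in> events" "prob (?R i) \<le> ?r" if "i \<in> {1..n+1}" for i
    using prob_bad_row[OF x0 that hb e8 m mass small] by auto
  have F: "?F \<in> events" "prob ?F \<le> 3 * exp 1 * exp (- (e\<^sup>2 / 256)) ^ (n - 1)"
    using prob_bad_freq[OF x0 e, of n] by auto
  let ?B = "(\<Union>i\<in>{1..n+1}. ?R i) \<union> ?F"
  have B: "?B \<in> events" using R F by (intro sets.Un sets.finite_UN) auto
  have eq: "{w \<in> space ?S. good n hb e \<alpha> w} = space ?S - ?B" unfolding good_def by blast
  show "{w \<in> space ?S. good n hb e \<alpha> w} \<in> events" unfolding eq using B by auto
  have "prob ?B \<le> prob (\<Union>i\<in>{1..n+1}. ?R i) + prob ?F"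
    by (intro measure_Un_le sets.finite_UN R F) auto
  also have "prob (\<Union>i\<in>{1..n+1}. ?R i) \<le> (\<Sum>i\<in>{1..n+1}. prob (?R i))"
    by (intro finite_measure_subadditive_finite) (use R in auto)
  also have "\<dots> \<le> (\<Sum>i\<in>{1..n+1}. ?r)" by (intro sum_mono R)
  also have "\<dots> = real (n+1) * ?r" by simp
  finally have "prob ?B \<le> real (n+1) * ?r + 3 * exp 1 * exp (- (e\<^sup>2 / 256)) ^ (n - 1)" using F by linarith
  then show "1 - (real (n + 1) * ?r + 3 * exp 1 * exp (- (e\<^sup>2 / 256)) ^ (n - 1)) \<le> prob {w \<in> space ?S. good n hb e \<alpha> w}"
    unfolding eq using prob_compl[OF B] by linarith
qed

text \<open>For a row \<open>i \<le> n\<close> nothing is asked of \<open>W\<close> at the test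
  point. The estimate therefore holds for every imputed score on one and the same event.\<close>

lemma good_wrank:
  assumes good: "good n hb e \<alpha> w" and hb: "0 < hb" and e: "0 < e" and i: "i \<in> {1..n+1}"
    and W: "\<And>j. j \<in> insert i {1..n} \<Longrightarrow> W j = V (w j)"
  shows "\<bar>wrank d hb n (\<lambda>i. fst (w i)) W i - pit (w i)\<bar> < e / 8"
proof (rule wrank_near[OF d_nonneg d_refl hb i])
  have nb: "\<not> bad_row n hb (e / 8) i w" using good i by (auto simp: good_def)
  have "(\<Sum>j\<in>{1..n}-{i}. locH d hb (fst (w i)) (fst (w j)) * ((if W j < W i then 1 else 0) - pit (w i) - e / 8))
      = (\<Sum>j\<in>{1..n}-{i}. T_up hb (e / 8) (w i) (w j))"
    by (rule sum.cong) (auto simp: T_up_def W)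
  then show "(\<Sum>j\<in>{1..n}-{i}. locH d hb (fst (w i)) (fst (w j)) * ((if W j < W i then 1 else 0) - pit (w i) - e / 8)) < - 2"
    using nb by (simp add: bad_row_def)
  have "(\<Sum>j\<in>{1..n}-{i}. locH d hb (fst (w i)) (fst (w j)) * (pit (w i) - e / 8 - (if W j < W i then 1 else 0)))
      = (\<Sum>j\<in>{1..n}-{i}. T_lo hb (e / 8) (w i) (w j))"
    by (rule sum.cong) (auto simp: T_lo_def W)
  then show "(\<Sum>j\<in>{1..n}-{i}. locH d hb (fst (w i)) (fst (w j)) * (pit (w i) - e / 8 - (if W j < W i then 1 else 0))) < - 2"
    using nb by (simp add: bad_row_def)
qed (use e F_bounds in \<open>auto simp: pit_def\<close>)

text \<open>\<open>good\<close> does not mention \<open>v\<close>, so this single event controls the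
  level for all \<open>v\<close> simultaneously.\<close>

lemma good_alpha_tilde:
  assumes good: "good n hb e \<alpha> w" and hb: "0 < hb" and e: "0 < e" and \<alpha>: "0 \<le> \<alpha>" "\<alpha> \<le> 1"
  shows "\<bar>alpha_tilde d hb n (\<lambda>i. fst (w i)) (\<lambda>i. V (w i)) \<alpha> v - \<alpha>\<bar> < e"
proof (rule alpha_tilde_near[OF \<alpha>(2) e, where w = "\<lambda>i. pit (w i)"])
  have nb: "\<not> bad_freq n e \<alpha> w" using good by (auto simp: good_def)
  show "\<bar>wrank d hb n (\<lambda>i. fst (w i)) ((\<lambda>i. V (w i))(n+1 := v)) i - pit (w i)\<bar> < e / 8" if "i \<in> {1..n}" for i
    by (rule good_wrank[OF good hb e]) (use that in auto)
  show "\<alpha> * real (n+1) \<le> (\<Sum>i=1..n. if pit (w i) < \<alpha> + e / 4 then 1 else 0)"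
    using nb \<alpha> unfolding bad_freq_def sum_subtractf by (simp add: algebra_simps)
  show "(\<Sum>i=1..n. if pit (w i) < \<alpha> - e / 2 then 1 else 0) + 1 < \<alpha> * real (n+1)"
    using nb \<alpha> unfolding bad_freq_def sum_subtractf by (simp add: algebra_simps)
  show "\<exists>i\<in>{1..n}. \<alpha> + 5 * e / 8 \<le> pit (w i) \<and> pit (w i) < \<alpha> + 7 * e / 8"
  proof (rule ccontr)
    assume "\<not> ?thesis"
    \<comment> \<open>With no \<open>pit\<close> value in the gap, the two indicators agree in every
      term.\<close>
    then have "(\<Sum>j\<in>{1..n}. ind (pit (w j) < \<alpha> + 5 * e / 8) - ind (pit (w j) < \<alpha> + 7 * e / 8)) \<ge> (\<Sum>j\<in>{1..n}. 0)"
      by (intro sum_mono) (auto simp: not_le not_less)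
    then show False using nb by (simp add: bad_freq_def)
  qed
qed

lemma prob_test_pit_less:
  assumes "x0 \<in> unit_cube" "0 < a" "a < 1"
  shows "{w \<in> space (sample_law PX MY K n x0). pit (w (n+1)) < a} \<in> sets (sample_law PX MY K n x0)"
    and "measure (sample_law PX MY K n x0) {w \<in> space (sample_law PX MY K n x0). pit (w (n+1)) < a} = a"
proof -
  let ?S = "sample_law PX MY K n x0"
  have c: "(\<lambda>w. w (n+1)) \<in> measurable ?S Z" by (rule sample_component) simp
  show "{w \<in> space ?S. pit (w (n+1)) < a} \<in> sets ?S"
    using measurable_compose[OF c pit_meas] by simp
  have "distr ?S (D x0) (\<lambda>w. w (n+1)) = D x0"
    unfolding sample_law_eq using distr_PiM_component[of "{1..n+1}" "Zlaw n x0" "n+1", OF Zlaw_prob] by simp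
  then have "measure (D x0) {z \<in> space Z. pit z < a} = measure (distr ?S (D x0) (\<lambda>w. w (n+1))) {z \<in> space Z. pit z < a}"
    by simp
  also have "\<dots> = measure ?S ((\<lambda>w. w (n+1)) -` {z \<in> space Z. pit z < a} \<inter> space ?S)"
    by (rule measure_distr) (use c in \<open>auto cong: measurable_cong_sets\<close>)
  also have "(\<lambda>w. w (n+1)) -` {z \<in> space Z. pit z < a} \<inter> space ?S = {w \<in> space ?S. pit (w (n+1)) < a}"
    using measurable_space[OF c] by auto
  finally show "measure ?S {w \<in> space ?S. pit (w (n+1)) < a} = a"
    using prob_pit_less_D[OF assms] by simp
qed

text \<open>Up to the complement of \<open>G\<close>, the event \<open>A\<close> lies between the
  events that the test \<open>pit\<close> is below \<open>\<alpha> - 2 * e\<close> and below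
  \<open>\<alpha> + 2 * e\<close>, whose probabilities are known exactly.\<close>

lemma prob_near:
  assumes x0: "x0 \<in> unit_cube" and e: "0 < \<alpha> - 2 * e" "\<alpha> + 2 * e < 1" "0 < e"
    and G: "{w \<in> space (sample_law PX MY K n x0). G w} \<in> sets (sample_law PX MY K n x0)"
    and A: "{w \<in> space (sample_law PX MY K n x0). A w} \<in> sets (sample_law PX MY K n x0)"
    and lo: "\<And>w. G w \<Longrightarrow> pit (w (n+1)) < \<alpha> - 2 * e \<Longrightarrow> A w"
    and up: "\<And>w. G w \<Longrightarrow> A w \<Longrightarrow> pit (w (n+1)) < \<alpha> + 2 * e"
  shows "\<bar>measure (sample_law PX MY K n x0) {w \<in> space (sample_law PX MY K n x0). A w} - \<alpha>\<bar>
    \<le> 2 * e + (1 - measure (sample_law PX MY K n x0) {w \<in> space (sample_law PX MY K n x0). G w})"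
proof -
  let ?S = "sample_law PX MY K n x0"
  interpret prob_space ?S by (rule sample_prob)
  let ?G = "{w \<in> space ?S. G w}" and ?A = "{w \<in> space ?S. A w}"
  let ?W = "\<lambda>a. {w \<in> space ?S. pit (w (n+1)) < a}"
  have W: "?W a \<in> events" "prob (?W a) = a" if "0 < a" "a < 1" for a
    using prob_test_pit_less[OF x0 that] by auto
  have cG: "prob (space ?S - ?G) = 1 - prob ?G" by (rule prob_compl[OF G])
  have "prob (?W (\<alpha> - 2 * e)) \<le> prob (?A \<union> (space ?S - ?G))"
    by (rule finite_measure_mono) (use lo A G in auto)
  also have "\<dots> \<le> prob ?A + prob (space ?S - ?G)" by (rule measure_Un_le) (use A G in auto)
  finally have 1: "\<alpha> - 2 * e \<le> prob ?A + (1 - prob ?G)" using W(2)[of "\<alpha> - 2 * e"] e cG by simp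
  have "prob ?A \<le> prob (?W (\<alpha> + 2 * e) \<union> (space ?S - ?G))"
    by (rule finite_measure_mono) (use up W(1)[of "\<alpha> + 2 * e"] e G in auto)
  also have "\<dots> \<le> prob (?W (\<alpha> + 2 * e)) + prob (space ?S - ?G)"
    by (rule measure_Un_le) (use W(1)[of "\<alpha> + 2 * e"] e G in auto)
  finally have 2: "prob ?A \<le> \<alpha> + 2 * e + (1 - prob ?G)" using W(2)[of "\<alpha> + 2 * e"] e cG by simp
  show ?thesis using 1 2 by linarith
qed

subsection \<open>Limits\<close>

text \<open>The small-ball condition at radius \<open>h n\<close> supplies
  \<open>m = h n powr \<beta> / L\<close> in \<open>prob_good\<close>. The assumption
  \<open>small\<close> there holds only for large \<open>n\<close>, so measurability too is stated
  eventually.\<close>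

lemma prob_good_tendsto_1:
  assumes x0: "x0 \<in> unit_cube" and e: "0 < e" "0 < \<alpha> - e" "\<alpha> + e < 1"
    and h_pos: "\<forall>n. h n > 0"
    and mass: "\<forall>n. \<forall>\<epsilon>. \<forall>z\<in>unit_cube. 0 < \<epsilon> \<longrightarrow> \<epsilon> \<le> h n \<longrightarrow>
                 measure PX {x \<in> space PX. d z x \<le> \<epsilon>} \<ge> \<epsilon> powr \<beta> / L"
    and h_lim: "h \<longlonglongrightarrow> 0"
    and h_rate: "filterlim (\<lambda>n. real n * h n powr \<beta> / ln (real n)) at_top sequentially"
  shows "eventually (\<lambda>n. {w \<in> space (sample_law PX MY K n x0). good n (h n) e \<alpha> w}
      \<in> sets (sample_law PX MY K n x0)) sequentially"
    and "(\<lambda>n. measure (sample_law PX MY K n x0) {w \<in> space (sample_law PX MY K n x0). good n (h n) e \<alpha> w}) \<longlonglongrightarrow> 1"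
proof -
  \<comment> \<open>Collects the constants of the row bound at accuracy \<open>e / 8\<close>,
    leaving the rate \<open>c * h n powr \<beta>\<close>.\<close>
  define c where "c = (e / 8)\<^sup>2 / 256 * exp (-1) / L"
  have c: "0 < c" using e L_pos by (simp add: c_def)
  let ?b = "\<lambda>n. real (n + 1) * (2 * exp 1 * exp (- c * h n powr \<beta>) ^ (n - 1)) + 3 * exp 1 * exp (- (e\<^sup>2 / 256)) ^ (n - 1)"
  have b: "?b \<longlonglongrightarrow> 0 + 0"
    by (intro tendsto_add union_bound_tendsto_0[OF c _ h_rate] exp_power_pred_tendsto_0) (use e in auto)
  have h0: "filterlim h (at_right 0) sequentially"
    using h_lim h_pos by (auto simp: filterlim_at less_imp_neq[symmetric] intro!: always_eventually)
  have "eventually (\<lambda>n. exp (- (e / 8 / (2 * L)) / h n) \<le> (e / 8 / 4 * exp (-1) / L) * h n powr \<beta>) sequentially"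
    by (rule eventually_compose_filterlim[OF eventually_exp_le_powr h0]) (use e L_pos in auto)
  then have ev: "eventually (\<lambda>n. {w \<in> space (sample_law PX MY K n x0). good n (h n) e \<alpha> w} \<in> sets (sample_law PX MY K n x0)
      \<and> 1 - ?b n \<le> measure (sample_law PX MY K n x0) {w \<in> space (sample_law PX MY K n x0). good n (h n) e \<alpha> w}) sequentially"
  proof eventually_elim
    case (elim n)
    have small: "exp (- (e / 8 / (2 * L)) / h n) \<le> e / 8 / 4 * (exp (-1) * (h n powr \<beta> / L))"
      using elim by (simp add: field_simps)
    have m: "0 \<le> h n powr \<beta> / L" using L_pos by simp
    have ms: "h n powr \<beta> / L \<le> measure PX {x' \<in> space PX. d x x' \<le> h n}" if "x \<in> unit_cube" for x
      using mass h_pos that by blast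
    have hn: "0 < h n" using h_pos by blast
    have eq: "- ((e / 8)\<^sup>2 / 256) * (exp (-1) * (h n powr \<beta> / L)) = - c * h n powr \<beta>" by (simp add: c_def)
    show ?case using prob_good[OF x0 hn e m ms small, of n] unfolding eq by blast
  qed
  then show "eventually (\<lambda>n. {w \<in> space (sample_law PX MY K n x0). good n (h n) e \<alpha> w}
      \<in> sets (sample_law PX MY K n x0)) sequentially" by eventually_elim blast
  show "(\<lambda>n. measure (sample_law PX MY K n x0) {w \<in> space (sample_law PX MY K n x0). good n (h n) e \<alpha> w}) \<longlonglongrightarrow> 1"
  proof (rule tendsto_sandwich)
    show "(\<lambda>n. 1 - ?b n) \<longlonglongrightarrow> 1" using tendsto_diff[OF tendsto_const[of 1] b] by simp
    show "eventually (\<lambda>n. measure (sample_law PX MY K n x0) {w \<in> space (sample_law PX MY K n x0). good n (h n) e \<alpha> w} \<le> 1) sequentially"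
      using prob_space.prob_le_1[OF sample_prob] by simp
    show "eventually (\<lambda>n. 1 - ?b n \<le> measure (sample_law PX MY K n x0) {w \<in> space (sample_law PX MY K n x0). good n (h n) e \<alpha> w}) sequentially"
      using ev by eventually_elim blast
  qed simp
qed

text \<open>Stated for abstract events \<open>A\<close> and \<open>G\<close>, so that calibrated and
  uncalibrated coverage are both instances.\<close>

lemma prob_tendsto_level:
  fixes A :: "nat \<Rightarrow> (nat \<Rightarrow> (real^'p) \<times> 'y) \<Rightarrow> bool"
  assumes x0: "x0 \<in> unit_cube" and \<alpha>: "0 < \<alpha>" "\<alpha> < 1"
    and G_sets: "\<And>e. 0 < e \<Longrightarrow> 0 < \<alpha> - e \<Longrightarrow> \<alpha> + e < 1 \<Longrightarrow>
      eventually (\<lambda>n. {w \<in> space (sample_law PX MY K n x0). G e n w} \<in> sets (sample_law PX MY K n x0)) sequentially"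
    and G_lim: "\<And>e. 0 < e \<Longrightarrow> 0 < \<alpha> - e \<Longrightarrow> \<alpha> + e < 1 \<Longrightarrow>
      (\<lambda>n. measure (sample_law PX MY K n x0) {w \<in> space (sample_law PX MY K n x0). G e n w}) \<longlonglongrightarrow> 1"
    and A: "\<And>n. {w \<in> space (sample_law PX MY K n x0). A n w} \<in> sets (sample_law PX MY K n x0)"
    and lo: "\<And>e n w. 0 < e \<Longrightarrow> G e n w \<Longrightarrow> pit (w (n+1)) < \<alpha> - 2 * e \<Longrightarrow> A n w"
    and up: "\<And>e n w. 0 < e \<Longrightarrow> G e n w \<Longrightarrow> A n w \<Longrightarrow> pit (w (n+1)) < \<alpha> + 2 * e"
  shows "(\<lambda>n. measure (sample_law PX MY K n x0) {w \<in> space (sample_law PX MY K n x0). A n w}) \<longlonglongrightarrow> \<alpha>"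
proof (rule tendstoI)
  fix r :: real assume r: "0 < r"
  \<comment> \<open>The first term leaves a total error of at most \<open>2 * e + r / 4\<close>,
    below \<open>r\<close>; the other two keep \<open>\<alpha> - 2 * e\<close> and
    \<open>\<alpha> + 2 * e\<close> strictly between 0 and 1.\<close>
  define e where "e = min (r / 4) (min (\<alpha> / 4) ((1 - \<alpha>) / 4))"
  have e: "0 < e" "e \<le> r / 4" "e \<le> \<alpha> / 4" "e \<le> (1 - \<alpha>) / 4" unfolding e_def using r \<alpha> by (auto simp: min_def)
  have e': "0 < \<alpha> - e" "\<alpha> + e < 1" and e2: "0 < \<alpha> - 2 * e" "\<alpha> + 2 * e < 1"
    using e(1) e(3,4) \<alpha> by auto
  have "eventually (\<lambda>n. 1 - r / 4 < measure (sample_law PX MY K n x0) {w \<in> space (sample_law PX MY K n x0). G e n w}) sequentially"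
    using order_tendstoD(1)[OF G_lim[OF e(1) e'], of "1 - r / 4"] r by simp
  with G_sets[OF e(1) e'] show "eventually (\<lambda>n. dist (measure (sample_law PX MY K n x0) {w \<in> space (sample_law PX MY K n x0). A n w}) \<alpha> < r) sequentially"
  proof eventually_elim
    case (elim n)
    have "\<bar>measure (sample_law PX MY K n x0) {w \<in> space (sample_law PX MY K n x0). A n w} - \<alpha>\<bar>
        \<le> 2 * e + (1 - measure (sample_law PX MY K n x0) {w \<in> space (sample_law PX MY K n x0). G e n w})"
      by (rule prob_near[OF x0 e2 e(1) elim(1) A]) (use lo up e(1) in blast)+
    then show ?case using elim(2) e(2) r by (simp add: dist_real_def)
  qed
qed

end

theorem theorem3:
  fixes PX :: "(real^'p) measure" and MY :: "'y measure" and K :: "real^'p \<Rightarrow> 'y measure"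
    and V :: "(real^'p) \<times> 'y \<Rightarrow> real" and d :: "real^'p \<Rightarrow> real^'p \<Rightarrow> real"
    and h :: "nat \<Rightarrow> real" and L \<beta> \<alpha> :: real and x0 :: "real^'p"
  assumes PX_prob: "prob_space PX" and PX_sets: "sets PX = sets borel"
    and PX_cube: "measure PX unit_cube = 1"
    and PX_dens: "\<exists>f. f \<in> borel_measurable borel \<and> PX = density lborel f
                     \<and> (\<forall>x\<in>unit_cube. ennreal (1 / L) \<le> f x)"
    and K_kernel: "K \<in> measurable borel (prob_algebra MY)"
    and V_meas: "V \<in> borel_measurable (borel \<Otimes>\<^sub>M MY)"
    and V_cont: "\<forall>x\<in>unit_cube. \<forall>v. measure (K x) {y \<in> space MY. V (x, y) = v} = 0"
    and d_meas: "(\<lambda>(a, b). d a b) \<in> borel_measurable (borel \<Otimes>\<^sub>M borel)"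
    and d_nonneg: "\<forall>a b. d a b \<ge> 0" and d_refl: "\<forall>a. d a a = 0"
    and h_pos: "\<forall>n. h n > 0"
    and L_pos: "L > 0" and \<beta>_nonneg: "\<beta> \<ge> 0"
    and lip: "\<forall>x\<in>unit_cube. \<forall>x'\<in>unit_cube. \<forall>v.
                 \<bar>cond_cdf MY K V x v - cond_cdf MY K V x' v\<bar> \<le> L * d x x'"
    and mass: "\<forall>n. \<forall>\<epsilon>. \<forall>z\<in>unit_cube. 0 < \<epsilon> \<longrightarrow> \<epsilon> \<le> h n \<longrightarrow>
                 measure PX {x \<in> space PX. d z x \<le> \<epsilon>} \<ge> \<epsilon> powr \<beta> / L"
    and h_lim: "h \<longlonglongrightarrow> 0"
    and h_rate: "filterlim (\<lambda>n. real n * h n powr \<beta> / ln (real n)) at_top sequentially"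
    and \<alpha>_range: "0 < \<alpha>" "\<alpha> < 1"
    and x0_cube: "x0 \<in> unit_cube"
  shows
    "(\<lambda>n. measure (sample_law PX MY K n x0)
        {\<omega> \<in> space (sample_law PX MY K n x0).
          V (\<omega> (n+1)) \<in> C_V d (h n) n (\<lambda>i. fst (\<omega> i)) (\<lambda>i. V (\<omega> i)) \<alpha>}) \<longlonglongrightarrow> \<alpha>
     \<and> (\<lambda>n. measure (sample_law PX MY K n x0)
        {\<omega> \<in> space (sample_law PX MY K n x0).
          ereal (V (\<omega> (n+1))) \<le> quantile \<alpha> (Ftest_cdf d (h n) n (\<lambda>i. fst (\<omega> i)) (\<lambda>i. V (\<omega> i)))})
        \<longlonglongrightarrow> \<alpha>
     \<and> (\<forall>\<epsilon>>0. (\<lambda>n. measure (sample_law PX MY K n x0)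
        {\<omega> \<in> space (sample_law PX MY K n x0).
          Max (range (\<lambda>v. \<bar>alpha_tilde d (h n) n (\<lambda>i. fst (\<omega> i)) (\<lambda>i. V (\<omega> i)) \<alpha> v - \<alpha>\<bar>)) < \<epsilon>})
        \<longlonglongrightarrow> 1)"
proof -
  interpret conformal_model PX MY K V d L
    by (rule conformal_model.intro; fact)
  note good_lim = prob_good_tendsto_1[OF x0_cube _ _ _ h_pos mass h_lim h_rate]
  have hn: "0 < h n" for n using h_pos by blast
  have \<alpha>: "0 \<le> \<alpha>" "\<alpha> \<le> 1" using \<alpha>_range by auto
  have X_meas: "(\<lambda>w. fst (w i)) \<in> borel_measurable (sample_law PX MY K n x0)" if "i \<in> {1..n+1}" for i n
    using measurable_compose[OF sample_component[OF that] measurable_fst] .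
  have V_meas': "(\<lambda>w. V (w i)) \<in> borel_measurable (sample_law PX MY K n x0)" if "i \<in> {1..n+1}" for i n
    using measurable_compose[OF sample_component[OF that] V_meas] .
  have n1: "n + 1 \<in> {1..n+1}" for n :: nat by simp
  let ?X = "\<lambda>w i. fst (w i)" and ?V = "\<lambda>w i. V (w i)"
  have rank: "\<bar>wrank d (h n) n (?X w) ((?V w)(n+1 := V (w (n+1)))) (n+1) - pit (w (n+1))\<bar> < e / 8"
    if "good n (h n) e \<alpha> w" "0 < e" for n e w
    by (rule good_wrank[OF that(1) hn that(2) n1]) auto
  show ?thesis
  proof (intro conjI allI impI)
    show "(\<lambda>n. measure (sample_law PX MY K n x0)
        {w \<in> space (sample_law PX MY K n x0). V (w (n+1)) \<in> C_V d (h n) n (?X w) (?V w) \<alpha>}) \<longlonglongrightarrow> \<alpha>"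
    proof (rule prob_tendsto_level[OF x0_cube \<alpha>_range good_lim])
      show "{w \<in> space (sample_law PX MY K n x0). V (w (n+1)) \<in> C_V d (h n) n (?X w) (?V w) \<alpha>}
          \<in> sets (sample_law PX MY K n x0)" for n
        using measurable_mem_C_V[OF d_meas X_meas V_meas' \<alpha>(2) V_meas'[OF n1]] by (simp add: pred_def)
      fix e :: real and n w assume e: "0 < e" and g: "good n (h n) e \<alpha> w"
      have mem: "V (w (n+1)) \<in> C_V d (h n) n (?X w) (?V w) \<alpha> \<longleftrightarrow>
          wrank d (h n) n (?X w) ((?V w)(n+1 := V (w (n+1)))) (n+1) < alpha_tilde d (h n) n (?X w) (?V w) \<alpha> (V (w (n+1)))"
        by (simp only: C_V_def mem_Collect_eq le_quantile_Ftest_cdf_iff)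
      \<comment> \<open>The rank error \<open>e / 8\<close> and the level error \<open>e\<close>
        together stay below \<open>2 * e\<close>.\<close>
      note near = rank[OF g e] good_alpha_tilde[OF g hn e \<alpha>, of "V (w (n+1))"]
      show "V (w (n+1)) \<in> C_V d (h n) n (?X w) (?V w) \<alpha>" if "pit (w (n+1)) < \<alpha> - 2 * e"
        unfolding mem using near that e by linarith
      show "pit (w (n+1)) < \<alpha> + 2 * e" if "V (w (n+1)) \<in> C_V d (h n) n (?X w) (?V w) \<alpha>"
        using that[unfolded mem] near e by linarith
    qed
    show "(\<lambda>n. measure (sample_law PX MY K n x0)
        {w \<in> space (sample_law PX MY K n x0). ereal (V (w (n+1))) \<le> quantile \<alpha> (Ftest_cdf d (h n) n (?X w) (?V w))}) \<longlonglongrightarrow> \<alpha>"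
      unfolding le_quantile_Ftest_cdf_iff
    proof (rule prob_tendsto_level[OF x0_cube \<alpha>_range good_lim])
      show "{w \<in> space (sample_law PX MY K n x0). wrank d (h n) n (?X w) ((?V w)(n+1 := V (w (n+1)))) (n+1) < \<alpha>}
          \<in> sets (sample_law PX MY K n x0)" for n
        using measurable_wrank[OF d_meas X_meas V_meas' V_meas'[OF n1] n1]
        by (intro borel_measurable_less borel_measurable_const)
      fix e :: real and n w assume e: "0 < e" and g: "good n (h n) e \<alpha> w"
      note near = rank[OF g e]
      show "wrank d (h n) n (?X w) ((?V w)(n+1 := V (w (n+1)))) (n+1) < \<alpha>" if "pit (w (n+1)) < \<alpha> - 2 * e"
        using near that e by linarith
      show "pit (w (n+1)) < \<alpha> + 2 * e" if "wrank d (h n) n (?X w) ((?V w)(n+1 := V (w (n+1)))) (n+1) < \<alpha>"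
        using near that e by linarith
    qed
    fix \<epsilon> :: real assume \<epsilon>: "0 < \<epsilon>"
    \<comment> \<open>The event for a smaller tolerance is contained in the one for
      \<open>\<epsilon>\<close>, so the tolerance may be shrunk until \<open>\<alpha> - e\<close>
      and \<open>\<alpha> + e\<close> lie in the open unit interval.\<close>
    define e where "e = min \<epsilon> (min (\<alpha> / 2) ((1 - \<alpha>) / 2))"
    have e: "0 < e" "e \<le> \<epsilon>" "e \<le> \<alpha> / 2" "e \<le> (1 - \<alpha>) / 2" unfolding e_def using \<epsilon> \<alpha>_range by (auto simp: min_def)
    have e': "0 < \<alpha> - e" "\<alpha> + e < 1" using e(1) e(3,4) \<alpha>_range by auto
    let ?P = "\<lambda>n. measure (sample_law PX MY K n x0) {w \<in> space (sample_law PX MY K n x0).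
        Max (range (\<lambda>v. \<bar>alpha_tilde d (h n) n (?X w) (?V w) \<alpha> v - \<alpha>\<bar>)) < \<epsilon>}"
    show "?P \<longlonglongrightarrow> 1"
    proof (rule tendsto_sandwich[OF _ _ good_lim(2)[OF e(1) e'] tendsto_const])
      show "eventually (\<lambda>n. ?P n \<le> 1) sequentially" using prob_space.prob_le_1[OF sample_prob] by simp
      show "eventually (\<lambda>n. measure (sample_law PX MY K n x0) {w \<in> space (sample_law PX MY K n x0). good n (h n) e \<alpha> w} \<le> ?P n) sequentially"
      proof (rule always_eventually, rule allI, rule finite_measure.finite_measure_mono[OF prob_space.finite_measure[OF sample_prob]])
        fix n
        show "{w \<in> space (sample_law PX MY K n x0). good n (h n) e \<alpha> w} \<subseteq> {w \<in> space (sample_law PX MY K n x0).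
            Max (range (\<lambda>v. \<bar>alpha_tilde d (h n) n (?X w) (?V w) \<alpha> v - \<alpha>\<bar>)) < \<epsilon>}"
          unfolding Max_alpha_tilde_less_iff[OF \<alpha>(2)]
          using e(2) by (auto intro!: less_le_trans[OF good_alpha_tilde[OF _ hn e(1) \<alpha>]])
        show "{w \<in> space (sample_law PX MY K n x0). Max (range (\<lambda>v. \<bar>alpha_tilde d (h n) n (?X w) (?V w) \<alpha> v - \<alpha>\<bar>)) < \<epsilon>}
            \<in> sets (sample_law PX MY K n x0)"
          using measurable_Max_alpha_tilde[OF d_meas X_meas V_meas' \<alpha>(2)] by (simp add: pred_def)
      qed
    qed
  qed
qed

end
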